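(* Let $\mu$ be a complex Borel measure on $\mathbb T$ with deformation $\mu(t)$ (quasi-definite), let $\vec n=(n_+,n_-)$ with integers $n_\pm\ge1$, and let $l\ge|\vec n|=n_++n_-$. Then the dual Laurent polynomials satisfy $$\overline{\varphi_2^{(l)}(z,t)}=(S_2)_{ll}^{-1}\,\overline{\varphi_{2,+1}^{(l)}(z,t)}=\overline{\varphi_{2,-1}^{(l)}(z,t)}=\bar z^{\nu_+(l)-1}\frac{\tau^{(l)}(t+[\bar z^{-1}]_2)}{\tau^{(l+1)}(t)}\quad\text{if }a(l)=1,$$ $$\overline{\varphi_2^{(l)}(z,t)}=(S_2)_{ll}^{-1}\,\overline{\varphi_{2,+2}^{(l)}(z,t)}=\overline{\varphi_{2,-2}^{(l)}(z,t)}=\bar z^{-\nu_-(l)}\frac{\tau^{(l)}(t-[\bar z]_1)}{\tau^{(l+1)}(t)}\quad\text{if }a(l)=2;$$ the other ``$+$'' associated polynomials satisfy $$\overline{\varphi_{2,+2}^{(l)}(z,t)}=\bar z^{-\nu_-(l_{+2})}\frac{\tau^{(l)}(t-[\bar z]_1)}{\tau^{(l)}(t)}\ \text{ if }a(l)=1,\qquad\overline{\varphi_{2,+1}^{(l)}(z,t)}=\bar z^{\nu_+(l_{+1})-1}\frac{\tau^{(l)}(t+[\bar z^{-1}]_2)}{\tau^{(l)}(t)}\ \text{ if }a(l)=2;$$ and the other ``$-$'' associated polynomials satisfy $$\overline{\varphi_{2,-2}^{(l)}(z,t)}=\bar z^{\nu_+(l)-1}\frac{\tau_{2,-2}^{(l)}(t+[\bar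 z^{-1}]_2)}{\tau^{(l+1)}(t)}\ \text{ if }a(l)=1,\qquad\overline{\varphi_{2,-1}^{(l)}(z,t)}=\bar z^{-\nu_-(l)}\frac{\tau_{2,-1}^{(l)}(t-[\bar z]_1)}{\tau^{(l+1)}(t)}\ \text{ if }a(l)=2.$$
   Context: $\mathbb T$ is the unit circle; a measure is quasi-definite if all its Toeplitz moment matrices $\big(\oint_{\mathbb T}z^{i-j}d\mu\big)_{i,j=0}^n$ are non-singular. Indices start at $0$; $\dagger$ is the conjugate transpose. Deformed measure: $d\mu(t,u)=\exp\big(\sum_{j\ge1}(t_{1j}u^j-t_{2j}u^{-j})\big)d\mu(u)$, with complex parameters $t$ such that the series $\sum_jt_{aj}u^j$ converge for all $u$ and $\mu(t)$ is quasi-definite. Extended ordering: $\chi=\chi_{\vec n}=(1,z,\dots,z^{n_+-1},z^{-1},\dots,z^{-n_-},z^{n_+},\dots,z^{2n_+-1},z^{-n_--1},\dots,z^{-2n_-},\dots)^\top$. $a(l)=1$ if $\chi^{(l)}$ is a non-negative power of $z$, $a(l)=2$ otherwise. $\nu_+(l)$ (resp. $\nu_-(l)$) is the number of $0\le l'\le l$ with $a(l')=1$ (resp. $2$). $l_{+a}$ is the smallest $l'\ge l$ with $a(l')=a$, $l_{-a}$ the largest $l'\le l$ with $a(l')=a$. $g=g(t)=\oint_{\mathbb T}\chi\chi^\dagger d\mu(t)=S_1(t)^{-1}S_2(t)$ with $S_1$ lower unitriangular, $S_2$ upper triangular. $\varphi_2^{(l)}(z,t)=((S_2(t)^{-1})^\dagger\chi(z))^{(l)}$.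 With $g^{[l]}$ the leading $l\times l$ block and $\chi^{[l]}$ the first $l$ components, $\varphi_{2,+a}^{(l)}=\chi^{(l_{+a})}-(\bar g_{0,l_{+a}},\dots,\bar g_{l-1,l_{+a}})((g^{[l]})^{-1})^\dagger\chi^{[l]}$, $\varphi_{2,-a}^{(l)}=e_{l_{-a}}^\top((g^{[l+1]})^{-1})^\dagger\chi^{[l+1]}$ ($e_j$ canonical basis vectors). $\tau$-functions: $\tau^{(l)}(t)=\det g^{[l]}(t)$; $\tau_{2,-a}^{(l)}(t)=(-1)^{l+l_{-a}}$ times the $l\times l$ minor of $g(t)$ with rows $\{0,\dots,l\}\setminus\{l_{-a}\}$ and columns $0,\dots,l-1$. Miwa shifts: $t\pm[w]_1$ is $t_{1j}\mapsto t_{1j}\pm w^j/j$ ($t_{2j}$ fixed), $t\pm[w]_2$ is $t_{2j}\mapsto t_{2j}\pm w^j/j$ ($t_{1j}$ fixed). A $\tau$-function at $t-[w]_1$ (resp. $t+[w]_2$) is the same determinant built from the measure $(1-wu)\,d\mu(t,u)$ (resp. $(1-w/u)\,d\mu(t,u)$); this is the literal meaning for $|w|<1$ and the polynomial continuation in $w$ otherwise. *)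

theory Defs
  imports
    "HOL-Analysis.Analysis"
    "Jordan_Normal_Form.Schur_Decomposition"
    "Jordan_Normal_Form.Gauss_Jordan_Elimination"
begin

(* HOL-Analysis and Jordan_Normal_Form share many names; matrices and vectors below are always
   those of Jordan_Normal_Form. *)
hide_const (open) Determinants.det Finite_Cartesian_Product.mat Finite_Cartesian_Product.vec

subsection \<open>Complex Borel measures on the unit circle\<close>

abbreviation circle :: "complex set" where "circle \<equiv> sphere 0 1"

abbreviation circle_borel :: "complex measure" where
  "circle_borel \<equiv> restrict_space borel circle"

(* Countably additive complex-valued set functions on the Borel subsets of the circle;
   the values on other sets are irrelevant. Taking all A i empty gives \<mu> {} = 0. *)
definition complex_measure :: "(complex set \<Rightarrow> complex) \<Rightarrow> bool" where
  "complex_measure \<mu> \<longleftrightarrow>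
     (\<forall>A :: nat \<Rightarrow> complex set. range A \<subseteq> sets circle_borel \<longrightarrow> disjoint_family A \<longrightarrow>
        (\<lambda>i. \<mu> (A i)) sums \<mu> (\<Union>i. A i))"

(* The positive part in the Jordan decomposition of a real signed measure. *)
definition pos_variation :: "(complex set \<Rightarrow> real) \<Rightarrow> complex measure" where
  "pos_variation \<rho> = measure_of circle (sets circle_borel)
     (\<lambda>A. SUP B\<in>{B \<in> sets circle_borel. B \<subseteq> A}. ennreal (\<rho> B))"

definition cm_integrable :: "(complex set \<Rightarrow> complex) \<Rightarrow> (complex \<Rightarrow> complex) \<Rightarrow> bool" where
  "cm_integrable \<mu> f \<longleftrightarrow>
     integrable (pos_variation (\<lambda>A. Re (\<mu> A))) f \<and>
     integrable (pos_variation (\<lambda>A. - Re (\<mu> A))) f \<and>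
     integrable (pos_variation (\<lambda>A. Im (\<mu> A))) f \<and>
     integrable (pos_variation (\<lambda>A. - Im (\<mu> A))) f"

definition cm_integral :: "(complex set \<Rightarrow> complex) \<Rightarrow> (complex \<Rightarrow> complex) \<Rightarrow> complex" where
  "cm_integral \<mu> f =
     integral\<^sup>L (pos_variation (\<lambda>A. Re (\<mu> A))) f
     - integral\<^sup>L (pos_variation (\<lambda>A. - Re (\<mu> A))) f
     + \<i> * (integral\<^sup>L (pos_variation (\<lambda>A. Im (\<mu> A))) f
            - integral\<^sup>L (pos_variation (\<lambda>A. - Im (\<mu> A))) f)"

(* The measure h d\<mu>. *)
definition cm_density ::
    "(complex \<Rightarrow> complex) \<Rightarrow> (complex set \<Rightarrow> complex) \<Rightarrow> complex set \<Rightarrow> complex" where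
  "cm_density h \<mu> A = cm_integral \<mu> (\<lambda>u. indicator A u * h u)"

definition quasi_definite :: "(complex set \<Rightarrow> complex) \<Rightarrow> bool" where
  "quasi_definite \<mu> \<longleftrightarrow>
     (\<forall>n. invertible_mat (mat (n + 1) (n + 1)
            (\<lambda>(i, j). cm_integral \<mu> (\<lambda>u. u powi (int i - int j)))))"


subsection \<open>Deformation and Miwa shifts\<close>

(* The times are t 1 j and t 2 j with j \<ge> 1; the values t a 0 are not used. *)
definition time_factor :: "(nat \<Rightarrow> nat \<Rightarrow> complex) \<Rightarrow> complex \<Rightarrow> complex" where
  "time_factor t u =
     exp (\<Sum>j. t 1 (Suc j) * u ^ Suc j - t 2 (Suc j) * inverse u ^ Suc j)"

definition deformed ::
    "(nat \<Rightarrow> nat \<Rightarrow> complex) \<Rightarrow> (complex set \<Rightarrow> complex) \<Rightarrow> complex set \<Rightarrow> complex" where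
  "deformed t \<mu> = cm_density (time_factor t) \<mu>"

definition convergent_times :: "(nat \<Rightarrow> nat \<Rightarrow> complex) \<Rightarrow> bool" where
  "convergent_times t \<longleftrightarrow>
     (\<forall>a\<in>{1, 2}. \<forall>u\<in>circle. summable (\<lambda>j. t a (Suc j) * u ^ Suc j))"

(* The effect on the measure of the shifts t - [w]_1 and t + [w]_2. For |w| < 1 this is
   what substituting the shifted times gives, see time_factor_shift below; for the other w
   it continues the moments polynomially in w. *)
definition miwa_minus_1 ::
    "complex \<Rightarrow> (complex set \<Rightarrow> complex) \<Rightarrow> complex set \<Rightarrow> complex" where
  "miwa_minus_1 w \<mu> = cm_density (\<lambda>u. 1 - w * u) \<mu>"

definition miwa_plus_2 ::
    "complex \<Rightarrow> (complex set \<Rightarrow> complex) \<Rightarrow> complex set \<Rightarrow> complex" where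
  "miwa_plus_2 w \<mu> = cm_density (\<lambda>u. 1 - w / u) \<mu>"


subsection \<open>The extended ordering of the Laurent monomials\<close>

definition chi_exp :: "nat \<Rightarrow> nat \<Rightarrow> nat \<Rightarrow> int" where
  "chi_exp np nm l =
     (let q = l div (np + nm); r = l mod (np + nm)
      in if r < np then int (q * np + r) else - int (q * nm + (r - np) + 1))"

definition chi :: "nat \<Rightarrow> nat \<Rightarrow> nat \<Rightarrow> complex \<Rightarrow> complex" where
  "chi np nm l z = z powi chi_exp np nm l"

definition kind :: "nat \<Rightarrow> nat \<Rightarrow> nat \<Rightarrow> nat" where
  "kind np nm l = (if chi_exp np nm l \<ge> 0 then 1 else 2)"

definition nu_plus :: "nat \<Rightarrow> nat \<Rightarrow> nat \<Rightarrow> nat" where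
  "nu_plus np nm l = card {l'. l' \<le> l \<and> kind np nm l' = 1}"

definition nu_minus :: "nat \<Rightarrow> nat \<Rightarrow> nat \<Rightarrow> nat" where
  "nu_minus np nm l = card {l'. l' \<le> l \<and> kind np nm l' = 2}"

definition next_index :: "nat \<Rightarrow> nat \<Rightarrow> nat \<Rightarrow> nat \<Rightarrow> nat" where
  "next_index np nm a l = (LEAST l'. l \<le> l' \<and> kind np nm l' = a)"

definition prev_index :: "nat \<Rightarrow> nat \<Rightarrow> nat \<Rightarrow> nat \<Rightarrow> nat" where
  "prev_index np nm a l = (GREATEST l'. l' \<le> l \<and> kind np nm l' = a)"


subsection \<open>Semi-infinite matrices and the Gauss--Borel factorization\<close>

type_synonym inf_mat = "nat \<Rightarrow> nat \<Rightarrow> complex"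

(* Only used for products all of whose entries are finite sums. *)
definition inf_mult :: "inf_mat \<Rightarrow> inf_mat \<Rightarrow> inf_mat" where
  "inf_mult A B i j = (\<Sum>k. A i k * B k j)"

definition inf_one :: inf_mat where
  "inf_one i j = (if i = j then 1 else 0)"

definition inf_adjoint :: "inf_mat \<Rightarrow> inf_mat" where
  "inf_adjoint A i j = cnj (A j i)"

definition lower_tri :: "inf_mat \<Rightarrow> bool" where
  "lower_tri A \<longleftrightarrow> (\<forall>i j. i < j \<longrightarrow> A i j = 0)"

definition lower_unitri :: "inf_mat \<Rightarrow> bool" where
  "lower_unitri A \<longleftrightarrow> lower_tri A \<and> (\<forall>i. A i i = 1)"

definition upper_tri :: "inf_mat \<Rightarrow> bool" where
  "upper_tri A \<longleftrightarrow> (\<forall>i j. j < i \<longrightarrow> A i j = 0)"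

(* The inverses of triangular matrices within the triangular matrices of the same shape;
   they exist (and are unique) iff the diagonal has no zero entry. *)
definition lower_inv :: "inf_mat \<Rightarrow> inf_mat" where
  "lower_inv A = (THE B. lower_tri B \<and> inf_mult A B = inf_one \<and> inf_mult B A = inf_one)"

definition upper_inv :: "inf_mat \<Rightarrow> inf_mat" where
  "upper_inv A = (THE B. upper_tri B \<and> inf_mult A B = inf_one \<and> inf_mult B A = inf_one)"

definition gauss_borel :: "inf_mat \<Rightarrow> inf_mat \<Rightarrow> inf_mat \<Rightarrow> bool" where
  "gauss_borel g S1 S2 \<longleftrightarrow>
     lower_unitri S1 \<and> upper_tri S2 \<and> g = inf_mult (lower_inv S1) S2"

definition moment_matrix :: "nat \<Rightarrow> nat \<Rightarrow> (complex set \<Rightarrow> complex) \<Rightarrow> inf_mat" where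
  "moment_matrix np nm \<mu> i j = cm_integral \<mu> (\<lambda>u. chi np nm i u * cnj (chi np nm j u))"

definition lead :: "nat \<Rightarrow> inf_mat \<Rightarrow> complex mat" where
  "lead l g = mat l l (\<lambda>(i, j). g i j)"

definition lead_chi :: "nat \<Rightarrow> nat \<Rightarrow> nat \<Rightarrow> complex \<Rightarrow> complex vec" where
  "lead_chi np nm l z = vec l (\<lambda>k. chi np nm k z)"


subsection \<open>Dual and associated Laurent polynomials\<close>

definition phi2 :: "nat \<Rightarrow> nat \<Rightarrow> inf_mat \<Rightarrow> nat \<Rightarrow> complex \<Rightarrow> complex" where
  "phi2 np nm S2 l z = (\<Sum>k. inf_adjoint (upper_inv S2) l k * chi np nm k z)"

definition phi2_plus ::
    "nat \<Rightarrow> nat \<Rightarrow> inf_mat \<Rightarrow> nat \<Rightarrow> nat \<Rightarrow> complex \<Rightarrow> complex" where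
  "phi2_plus np nm g a l z =
     chi np nm (next_index np nm a l) z
     - vec l (\<lambda>i. cnj (g i (next_index np nm a l)))
       \<bullet> (mat_adjoint (the (mat_inverse (lead l g))) *\<^sub>v lead_chi np nm l z)"

definition phi2_minus ::
    "nat \<Rightarrow> nat \<Rightarrow> inf_mat \<Rightarrow> nat \<Rightarrow> nat \<Rightarrow> complex \<Rightarrow> complex" where
  "phi2_minus np nm g a l z =
     unit_vec (l + 1) (prev_index np nm a l)
       \<bullet> (mat_adjoint (the (mat_inverse (lead (l + 1) g))) *\<^sub>v lead_chi np nm (l + 1) z)"


subsection \<open>Tau functions\<close>

definition tau :: "nat \<Rightarrow> nat \<Rightarrow> (complex set \<Rightarrow> complex) \<Rightarrow> nat \<Rightarrow> complex" where
  "tau np nm \<mu> l = det (lead l (moment_matrix np nm \<mu>))"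

definition tau2_minus ::
    "nat \<Rightarrow> nat \<Rightarrow> nat \<Rightarrow> (complex set \<Rightarrow> complex) \<Rightarrow> nat \<Rightarrow> complex" where
  "tau2_minus np nm a \<mu> l =
     (-1) ^ (l + prev_index np nm a l)
     * det (mat_delete (lead (l + 1) (moment_matrix np nm \<mu>)) (prev_index np nm a l) l)"


subsection \<open>Variation measures and integrability\<close>

lemma circle_sets: "sets circle_borel \<subseteq> Pow circle"
  using sets.space_closed[of circle_borel] by (simp add: space_restrict_space)

lemma signed_empty:
  fixes \<rho> :: "complex set \<Rightarrow> real"
  assumes ca: "\<And>A :: nat \<Rightarrow> complex set. range A \<subseteq> sets circle_borel \<Longrightarrow> disjoint_family A \<Longrightarrow>
        (\<lambda>i. \<rho> (A i)) sums \<rho> (\<Union>i. A i)"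
  shows "\<rho> {} = 0"
proof -
  have "(\<lambda>i::nat. \<rho> {}) sums \<rho> {}"
    using ca[of "\<lambda>_. {}"] by (simp add: disjoint_family_on_def)
  then have "(\<lambda>i::nat. \<rho> {}) \<longlonglongrightarrow> 0"
    by (intro summable_LIMSEQ_zero) (rule sums_summable)
  then show ?thesis by (simp add: LIMSEQ_const_iff)
qed

lemma signed_Un:
  fixes \<rho> :: "complex set \<Rightarrow> real"
  assumes ca: "\<And>A :: nat \<Rightarrow> complex set. range A \<subseteq> sets circle_borel \<Longrightarrow> disjoint_family A \<Longrightarrow>
        (\<lambda>i. \<rho> (A i)) sums \<rho> (\<Union>i. A i)"
    and A: "A \<in> sets circle_borel" and B: "B \<in> sets circle_borel" and AB: "A \<inter> B = {}"
  shows "\<rho> (A \<union> B) = \<rho> A + \<rho> B"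
proof -
  have "range (binaryset A B) \<subseteq> sets circle_borel"
    unfolding range_binaryset_eq using A B by simp
  moreover have "disjoint_family (binaryset A B)"
    using AB by (simp add: disjoint_family_on_def binaryset_def Int_commute)
  ultimately have "(\<lambda>i. \<rho> (binaryset A B i)) sums \<rho> (A \<union> B)"
    using ca[of "binaryset A B"] by (simp only: UN_binaryset_eq)
  moreover have "(\<lambda>i. \<rho> (binaryset A B i)) sums (\<rho> A + \<rho> B)"
    by (rule binaryset_sums) (rule signed_empty[of \<rho>, OF ca])
  ultimately show ?thesis by (rule sums_unique2)
qed

lemma signed_bounded:
  fixes \<rho> :: "complex set \<Rightarrow> real"
  assumes ca: "\<And>A :: nat \<Rightarrow> complex set. range A \<subseteq> sets circle_borel \<Longrightarrow> disjoint_family A \<Longrightarrow>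
        (\<lambda>i. \<rho> (A i)) sums \<rho> (\<Union>i. A i)"
  shows "\<exists>K. \<forall>B\<in>sets circle_borel. \<bar>\<rho> B\<bar> \<le> K"
proof (rule ccontr)
  let ?S = "sets circle_borel"
  note e0 = signed_empty[of \<rho>, OF ca] and add = signed_Un[of \<rho>, OF ca]
  define unb where "unb E \<longleftrightarrow> E \<in> ?S \<and> (\<forall>K. \<exists>B\<in>?S. B \<subseteq> E \<and> \<bar>\<rho> B\<bar> > K)" for E
  assume "\<not> ?thesis"
  then have K: "\<exists>B\<in>?S. \<bar>\<rho> B\<bar> > K" for K
    by (meson not_le)
  have "space circle_borel = circle"
    by (simp add: space_restrict_space)
  then have "circle \<in> ?S"
    using sets.top[of circle_borel] by (simp only:)
  moreover have "B \<subseteq> circle" if "B \<in> ?S" for B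
    using circle_sets that by blast
  ultimately have top: "unb circle"
    unfolding unb_def using K by meson
  have step: "\<exists>E'. unb E' \<and> E' \<subseteq> E \<and> \<bar>\<rho> (E - E')\<bar> \<ge> 1" if E: "unb E" for E
  proof -
    from E obtain B where B: "B \<in> ?S" "B \<subseteq> E" "\<bar>\<rho> B\<bar> > \<bar>\<rho> E\<bar> + 1"
      unfolding unb_def by blast
    have ES: "E \<in> ?S" using E by (simp add: unb_def)
    have D: "E - B \<in> ?S" using ES B by auto
    have "\<rho> E = \<rho> B + \<rho> (E - B)"
      using add[of B "E - B"] B D by (simp add: Un_absorb1)
    with B have big: "\<bar>\<rho> (E - B)\<bar> \<ge> 1" by linarith
    have "unb B \<or> unb (E - B)"
    proof (rule ccontr)
      assume "\<not> ?thesis"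
      then have "\<not> unb B" "\<not> unb (E - B)" by simp_all
      then obtain K1 K2 where K: "\<And>C. C \<in> ?S \<Longrightarrow> C \<subseteq> B \<Longrightarrow> \<bar>\<rho> C\<bar> \<le> K1"
         "\<And>C. C \<in> ?S \<Longrightarrow> C \<subseteq> E - B \<Longrightarrow> \<bar>\<rho> C\<bar> \<le> K2"
        unfolding unb_def by (meson B(1) D not_le)
      have "\<bar>\<rho> C\<bar> \<le> K1 + K2" if C: "C \<in> ?S" "C \<subseteq> E" for C
      proof -
        have "\<rho> C = \<rho> (C \<inter> B) + \<rho> (C - B)"
          using add[of "C \<inter> B" "C - B"] C B by (simp add: Int_Diff_Un Int_Diff_disjoint)
        moreover have "\<bar>\<rho> (C \<inter> B)\<bar> \<le> K1" by (rule K) (use C B in auto)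
        moreover have "\<bar>\<rho> (C - B)\<bar> \<le> K2" by (rule K) (use C B in auto)
        ultimately show ?thesis by linarith
      qed
      with E show False unfolding unb_def by (meson not_less)
    qed
    then show ?thesis
    proof
      assume "unb B" with B big show ?thesis by blast
    next
      assume "unb (E - B)"
      moreover have "E - (E - B) = B" using B by auto
      ultimately show ?thesis using B by (intro exI[of _ "E - B"]) auto
    qed
  qed
  define f where "f E = (SOME E'. unb E' \<and> E' \<subseteq> E \<and> \<bar>\<rho> (E - E')\<bar> \<ge> 1)" for E
  have f: "unb (f E) \<and> f E \<subseteq> E \<and> \<bar>\<rho> (E - f E)\<bar> \<ge> 1" if "unb E" for E
    unfolding f_def using someI_ex[OF step[OF that]] .
  define F where "F n = (f ^^ n) circle" for n
  have F: "unb (F n)" for n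
    by (induction n) (simp_all only: F_def funpow.simps id_apply o_apply top f)
  have FS: "F (Suc n) = f (F n)" for n by (simp add: F_def)
  have dec: "decseq F"
    by (rule decseq_SucI) (simp only: FS f F)
  define A where "A n = F n - F (Suc n)" for n
  have "disjoint_family A"
    unfolding disjoint_family_on_def
  proof (intro ballI impI)
    fix m n :: nat assume "m \<noteq> n"
    moreover have "A i \<inter> A j = {}" if "i < j" for i j
      using decseqD[OF dec, of "Suc i" j] that by (auto simp: A_def)
    ultimately show "A m \<inter> A n = {}"
      by (metis Int_commute linorder_neqE_nat)
  qed
  moreover have "range A \<subseteq> ?S"
  proof -
    have "F n \<in> ?S" for n
      using F[of n] unfolding unb_def by (rule conjunct1)
    then show ?thesis by (auto simp: A_def)
  qed
  ultimately have "summable (\<lambda>n. \<rho> (A n))"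
    using ca sums_summable by blast
  then have "(\<lambda>n. \<rho> (A n)) \<longlonglongrightarrow> 0" by (rule summable_LIMSEQ_zero)
  then have "\<forall>\<^sub>F n in sequentially. \<bar>\<rho> (A n)\<bar> < 1"
    using tendstoD[of "\<lambda>n. \<rho> (A n)" 0 sequentially 1] by simp
  then obtain n where "\<bar>\<rho> (A n)\<bar> < 1" by (auto simp: eventually_sequentially)
  with f[OF F[of n]] show False by (simp add: A_def FS)
qed

lemma emeasure_pos_variation:
  fixes \<rho> :: "complex set \<Rightarrow> real"
  assumes ca: "\<And>A :: nat \<Rightarrow> complex set. range A \<subseteq> sets circle_borel \<Longrightarrow> disjoint_family A \<Longrightarrow>
        (\<lambda>i. \<rho> (A i)) sums \<rho> (\<Union>i. A i)"
    and A: "A \<in> sets circle_borel"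
  shows "emeasure (pos_variation \<rho>) A = (SUP B\<in>{B \<in> sets circle_borel. B \<subseteq> A}. ennreal (\<rho> B))"
proof -
  let ?S = "sets circle_borel"
  define P where "P A = (SUP B\<in>{B \<in> ?S. B \<subseteq> A}. ennreal (\<rho> B))" for A
  have Pub: "ennreal (\<rho> B) \<le> P A" if "B \<in> ?S" "B \<subseteq> A" for A B
    unfolding P_def by (rule SUP_upper) (use that in auto)
  have "countably_additive ?S P"
    unfolding countably_additive_def
  proof (intro allI impI)
    fix A :: "nat \<Rightarrow> complex set"
    assume AS: "range A \<subseteq> ?S" and dis: "disjoint_family A" and "\<Union> (range A) \<in> ?S"
    show "(\<Sum>i. P (A i)) = P (\<Union> (range A))"
    proof (rule antisym)
      show "P (\<Union> (range A)) \<le> (\<Sum>i. P (A i))"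
        unfolding P_def[of "\<Union> (range A)"]
      proof (rule SUP_least)
        fix B assume "B \<in> {B \<in> ?S. B \<subseteq> \<Union> (range A)}"
        then have B: "B \<in> ?S" "B \<subseteq> \<Union> (range A)" by auto
        have BA: "B \<inter> A i \<in> ?S" for i using B AS by auto
        have "(\<lambda>i. \<rho> (B \<inter> A i)) sums \<rho> (\<Union>i. B \<inter> A i)"
          by (rule ca) (use BA dis in \<open>auto simp: disjoint_family_on_def\<close>)
        moreover have "(\<Union>i. B \<inter> A i) = B" using B by auto
        ultimately have "(\<lambda>n. \<Sum>i<n. \<rho> (B \<inter> A i)) \<longlonglongrightarrow> \<rho> B" by (simp add: sums_def)
        then have "(\<lambda>n. ennreal (\<Sum>i<n. \<rho> (B \<inter> A i))) \<longlonglongrightarrow> ennreal (\<rho> B)"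
          by (intro tendsto_ennrealI)
        moreover have "ennreal (\<Sum>i<n. \<rho> (B \<inter> A i)) \<le> (\<Sum>i. P (A i))" for n
        proof -
          have "ennreal (\<Sum>i<n. \<rho> (B \<inter> A i)) \<le> ennreal (\<Sum>i<n. max 0 (\<rho> (B \<inter> A i)))"
            by (intro ennreal_leI sum_mono) auto
          also have "\<dots> = (\<Sum>i<n. ennreal (max 0 (\<rho> (B \<inter> A i))))"
            by (rule sum_ennreal[symmetric]) auto
          also have "\<dots> \<le> (\<Sum>i<n. P (A i))"
          proof (rule sum_mono)
            fix i
            have "ennreal (max 0 (\<rho> (B \<inter> A i))) = ennreal (\<rho> (B \<inter> A i))"
              by (simp add: max_def ennreal_neg)
            then show "ennreal (max 0 (\<rho> (B \<inter> A i))) \<le> P (A i)"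
              using Pub[OF BA[of i], of "A i"] by simp
          qed
          also have "\<dots> \<le> (\<Sum>i. P (A i))" by (rule sum_le_suminf) auto
          finally show ?thesis .
        qed
        ultimately show "ennreal (\<rho> B) \<le> (\<Sum>i. P (A i))"
          by (intro LIMSEQ_le_const2) auto
      qed
      have part: "(\<Sum>i<n. P (A i)) \<le> P (\<Union> (range A))" for n
      proof -
        have "(\<Sum>i<n. P (A i)) \<le> P (\<Union>i<n. A i)"
        proof (induction n)
          case (Suc n)
          have "P (\<Union>i<n. A i) + P (A n) \<le> P (\<Union>i<Suc n. A i)"
          proof -
            let ?X = "{B \<in> ?S. B \<subseteq> (\<Union>i<n. A i)}" and ?Y = "{B \<in> ?S. B \<subseteq> A n}"
            have "ennreal (\<rho> B) + ennreal (\<rho> C) \<le> P (\<Union>i<Suc n. A i)"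
              if B: "B \<in> ?X" and C: "C \<in> ?Y" for B C
            proof -
              have BC: "B \<inter> C = {}"
              proof -
                have "A i \<inter> A n = {}" if "i < n" for i
                  using dis that unfolding disjoint_family_on_def by (metis UNIV_I nat_neq_iff)
                moreover have "B \<subseteq> (\<Union>i<n. A i)" "C \<subseteq> A n"
                  using B C by simp_all
                ultimately show ?thesis by blast
              qed
              have s: "\<rho> (B \<union> C) = \<rho> B + \<rho> C"
                by (rule signed_Un[of \<rho>, OF ca]) (use B C BC in auto)
              consider "\<rho> B \<ge> 0" "\<rho> C \<ge> 0" | "\<rho> B < 0" | "\<rho> C < 0" by linarith
              then show ?thesis
              proof cases
                case 1
                then have "ennreal (\<rho> B) + ennreal (\<rho> C) = ennreal (\<rho> (B \<union> C))"
                  by (simp add: s)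
                also have "\<dots> \<le> P (\<Union>i<Suc n. A i)"
                  by (rule Pub) (use B C in \<open>auto simp: lessThan_Suc\<close>)
                finally show ?thesis .
              next
                case 2
                have "ennreal (\<rho> C) \<le> P (\<Union>i<Suc n. A i)"
                  by (rule Pub) (use C in \<open>auto simp: lessThan_Suc\<close>)
                with 2 show ?thesis by (simp add: ennreal_neg)
              next
                case 3
                have "ennreal (\<rho> B) \<le> P (\<Union>i<Suc n. A i)"
                  by (rule Pub) (use B in \<open>auto simp: lessThan_Suc\<close>)
                with 3 show ?thesis by (simp add: ennreal_neg)
              qed
            qed
            note le = this
            have ne: "?X \<noteq> {}" "?Y \<noteq> {}" by auto
            have "P (\<Union>i<n. A i) + P (A n) = (SUP B\<in>?X. ennreal (\<rho> B) + (SUP C\<in>?Y. ennreal (\<rho> C)))"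
              unfolding P_def using ne by (simp add: ennreal_SUP_add_left)
            also have "\<dots> = (SUP B\<in>?X. SUP C\<in>?Y. ennreal (\<rho> B) + ennreal (\<rho> C))"
              using ne by (simp add: ennreal_SUP_add_right)
            also have "\<dots> \<le> P (\<Union>i<Suc n. A i)"
              by (intro SUP_least le)
            finally show ?thesis .
          qed
          moreover have "(\<Sum>i<Suc n. P (A i)) \<le> P (\<Union>i<n. A i) + P (A n)"
            unfolding sum.lessThan_Suc by (rule add_right_mono) (rule Suc)
          ultimately show ?case by (rule order_trans[rotated])
        qed (simp add: P_def)
        also have "\<dots> \<le> P (\<Union> (range A))"
          unfolding P_def by (rule SUP_subset_mono) auto
        finally show ?thesis .
      qed
      then show "(\<Sum>i. P (A i)) \<le> P (\<Union> (range A))"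
        by (intro suminf_le_const) auto
    qed
  qed
  moreover have "positive ?S P"
  proof -
    have "{B \<in> ?S. B \<subseteq> {}} = {{}}" by auto
    then show ?thesis by (simp add: positive_def P_def signed_empty[of \<rho>, OF ca])
  qed
  moreover have "pos_variation \<rho> = measure_of circle ?S P"
    unfolding pos_variation_def by (rule arg_cong[where f = "measure_of circle ?S"]) (simp add: P_def fun_eq_iff)
  moreover have "sigma_sets circle ?S = ?S"
    using sets.sigma_sets_eq[of circle_borel] by (simp add: space_restrict_space)
  ultimately have "emeasure (pos_variation \<rho>) A = P A"
    using emeasure_measure_of[of "pos_variation \<rho>" circle ?S P A] A circle_sets
    by (simp add: sets_measure_of)
  then show ?thesis by (simp only: P_def)
qed

lemma integrable_pos_variation:
  fixes \<rho> :: "complex set \<Rightarrow> real" and f :: "complex \<Rightarrow> complex"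
  assumes ca: "\<And>A :: nat \<Rightarrow> complex set. range A \<subseteq> sets circle_borel \<Longrightarrow> disjoint_family A \<Longrightarrow>
        (\<lambda>i. \<rho> (A i)) sums \<rho> (\<Union>i. A i)"
    and f: "f \<in> borel_measurable circle_borel" and b: "\<And>u. u \<in> circle \<Longrightarrow> norm (f u) \<le> K"
  shows "integrable (pos_variation \<rho>) f"
proof -
  let ?M = "pos_variation \<rho>"
  obtain C where C: "\<And>B. B \<in> sets circle_borel \<Longrightarrow> \<bar>\<rho> B\<bar> \<le> C"
    using signed_bounded[of \<rho>] ca by blast
  have sp: "space ?M = circle"
    unfolding pos_variation_def using circle_sets by (rule space_measure_of)
  have ss: "sets ?M = sets circle_borel"
    unfolding pos_variation_def using circle_sets
    using sets.sigma_sets_eq[of circle_borel]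
    by (simp add: sets_measure_of space_restrict_space)
  have "emeasure ?M circle \<le> (SUP B\<in>{B \<in> sets circle_borel. B \<subseteq> circle}. ennreal (\<rho> B))"
    unfolding pos_variation_def emeasure_measure_of_conv by simp
  also have "\<dots> \<le> ennreal C"
    by (rule SUP_least) (use C in \<open>auto intro!: ennreal_leI simp: abs_le_iff\<close>)
  finally have "finite_measure ?M"
    by (intro finite_measureI) (auto simp: sp top_unique)
  moreover have "f \<in> borel_measurable ?M"
    using f measurable_cong_sets[OF ss refl] by blast
  ultimately show ?thesis
    using b by (intro finite_measure.integrable_const_bound[where B = K]) (auto simp: sp)
qed

lemma complex_measure_integrable:
  assumes \<mu>: "complex_measure \<mu>"
    and f: "f \<in> borel_measurable circle_borel" and b: "\<And>u. u \<in> circle \<Longrightarrow> norm (f u) \<le> K"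
  shows "cm_integrable \<mu> f"
proof -
  have ca: "(\<lambda>i. \<mu> (A i)) sums \<mu> (\<Union>i. A i)"
    if "range A \<subseteq> sets circle_borel" "disjoint_family A" for A :: "nat \<Rightarrow> _"
    using \<mu> that by (auto simp: complex_measure_def)
  show ?thesis
    unfolding cm_integrable_def
    by (intro conjI integrable_pos_variation[OF _ f b] sums_minus sums_Re sums_Im ca)
qed


subsection \<open>The time factor\<close>

lemma Ln_sums:
  fixes x :: complex
  assumes "norm x < 1"
  shows "(\<lambda>j. x ^ Suc j / of_nat (Suc j)) sums (- Ln (1 - x))"
proof -
  have "(\<lambda>n. (-1) ^ Suc n / of_nat n * (- x) ^ n) sums ln (1 + (- x))"
    by (rule Ln_series) (use assms in simp)
  then have "(\<lambda>n. - ((-1) ^ Suc n / of_nat n * (- x) ^ n)) sums (- Ln (1 - x))"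
    by (intro sums_minus) simp
  moreover have *: "- ((-1) ^ Suc n / of_nat n * (- x) ^ n) = x ^ n / of_nat n" for n
  proof -
    have "(- x) ^ n = (-1) ^ n * x ^ n"
      by (rule power_minus)
    moreover have "(-1 :: complex) ^ n * (-1) ^ n = 1"
      by (metis left_minus_one_mult_self mult.right_neutral)
    ultimately show ?thesis
      by (simp add: divide_inverse)
  qed
  ultimately have "(\<lambda>n. x ^ n / of_nat n) sums (- Ln (1 - x))"
    by (simp only: *)
  then show ?thesis
    by (subst sums_Suc_iff) simp
qed

lemma time_factor_shift:
  assumes t: "convergent_times t" and u: "u \<in> circle" and w: "norm w < 1"
  shows "time_factor (t(1 := \<lambda>j. t 1 j - w ^ j / of_nat j)) u = (1 - w * u) * time_factor t u"
    and "time_factor (t(2 := \<lambda>j. t 2 j + w ^ j / of_nat j)) u = (1 - w / u) * time_factor t u"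
proof -
  have nu: "norm u = 1" "norm (inverse u) = 1"
    using u by (auto simp: norm_inverse)
  have s: "summable (\<lambda>j. t 1 (Suc j) * u ^ Suc j - t 2 (Suc j) * inverse u ^ Suc j)"
    using t nu u unfolding convergent_times_def by (intro summable_diff) (auto simp: dist_norm)
  have a1: "norm (w * u) < 1" and a2: "norm (w / u) < 1"
    using nu w by (auto simp: norm_mult norm_divide)
  have n1: "1 - w * u \<noteq> 0" and n2: "1 - w / u \<noteq> 0"
    using a1 a2 by (metis eq_iff_diff_eq_0 less_irrefl norm_one)+
  have "(\<Sum>j. (t 1 (Suc j) * u ^ Suc j - t 2 (Suc j) * inverse u ^ Suc j)
             - (w * u) ^ Suc j / of_nat (Suc j))
        = (\<Sum>j. t 1 (Suc j) * u ^ Suc j - t 2 (Suc j) * inverse u ^ Suc j) + Ln (1 - w * u)"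
    using sums_unique[OF sums_diff[OF summable_sums[OF s] Ln_sums[OF a1]]] by simp
  then show "time_factor (t(1 := \<lambda>j. t 1 j - w ^ j / of_nat j)) u
             = (1 - w * u) * time_factor t u"
    using n1 unfolding time_factor_def
    by (simp add: exp_add mult.commute power_mult_distrib algebra_simps del: of_nat_Suc power_Suc)
  have "(\<Sum>j. (t 1 (Suc j) * u ^ Suc j - t 2 (Suc j) * inverse u ^ Suc j)
             - (w / u) ^ Suc j / of_nat (Suc j))
        = (\<Sum>j. t 1 (Suc j) * u ^ Suc j - t 2 (Suc j) * inverse u ^ Suc j) + Ln (1 - w / u)"
    using sums_unique[OF sums_diff[OF summable_sums[OF s] Ln_sums[OF a2]]] by simp
  then show "time_factor (t(2 := \<lambda>j. t 2 j + w ^ j / of_nat j)) u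
             = (1 - w / u) * time_factor t u"
    using n2 unfolding time_factor_def
    by (simp add: exp_add mult.commute power_mult_distrib algebra_simps divide_inverse
        del: of_nat_Suc power_Suc)
qed

(* Convergence on the circle alone may leave the time factor unbounded, but for series that
   converge on the whole plane its integrability is automatic. *)
lemma time_factor_integrable:
  assumes \<mu>: "complex_measure \<mu>"
    and t: "\<And>a u. a \<in> {1, 2} \<Longrightarrow> summable (\<lambda>j. t a (Suc j) * u ^ Suc j)"
  shows "cm_integrable \<mu> (time_factor t)"
proof -
  define P where "P a u = (\<Sum>j. t a (Suc j) * u ^ j)" for a u
  have s: "summable (\<lambda>j. t a (Suc j) * u ^ j)" if a: "a \<in> {1, 2}" for a u
  proof (cases "u = 0")
    case False
    have "summable (\<lambda>j. (t a (Suc j) * u ^ Suc j) / u)"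
      by (intro summable_divide t a)
    moreover have "(t a (Suc j) * u ^ Suc j) / u = t a (Suc j) * u ^ j" for j
      using False by simp
    ultimately show ?thesis by (simp only:)
  next
    case True
    have "summable (\<lambda>j. t a (Suc j) * 0 ^ j)"
      by (rule summable_finite[of "{0}"]) (auto simp: power_0_left)
    then show ?thesis using True by (simp only:)
  qed
  have c: "continuous_on UNIV (P a)" if "a \<in> {1, 2}" for a
    unfolding P_def
    by (intro continuous_at_imp_continuous_on ballI isCont_powser_converges_everywhere s that)
  have eq: "time_factor t u = exp (u * P 1 u - inverse u * P 2 (inverse u))" for u
    unfolding time_factor_def P_def
  proof -
    have "(\<Sum>j. t a (Suc j) * v ^ Suc j) = v * (\<Sum>j. t a (Suc j) * v ^ j)"
      if "a \<in> {1, 2}" for a v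
      using suminf_mult[OF s[OF that, of v], of v] by (simp add: ac_simps)
    then show "exp (\<Sum>j. t 1 (Suc j) * u ^ Suc j - t 2 (Suc j) * inverse u ^ Suc j) =
      exp (u * (\<Sum>j. t 1 (Suc j) * u ^ j) - inverse u * (\<Sum>j. t 2 (Suc j) * inverse u ^ j))"
      by (subst suminf_diff[OF t t, symmetric]) simp_all
  qed
  have co: "continuous_on circle (time_factor t)"
    unfolding eq[abs_def]
    by (intro continuous_intros continuous_on_compose2[OF c]) auto
  have "bounded (time_factor t ` circle)"
    using compact_imp_bounded[OF compact_continuous_image[OF co compact_sphere]] .
  then obtain K where "\<And>u. u \<in> circle \<Longrightarrow> norm (time_factor t u) \<le> K"
    unfolding bounded_iff by blast
  then show ?thesis
    using co by (intro complex_measure_integrable \<mu> borel_measurable_continuous_on_restrict) auto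
qed

end

theory Submission
  imports Defs
begin

text \<open>
  Write \<open>x\<close> for the conjugate of \<open>z\<close>, \<open>e k\<close> for the exponent of \<open>\<chi>\<^sup>(\<^sup>k\<^sup>)\<close> and \<open>c k\<close> for the moments of the
  deformed measure, so that \<open>g i j = c (e i - e j)\<close>. All the polynomials in the theorem are
  determinants in which one row consists of the powers \<open>x\<^sup>e\<^sup>(\<^sup>j\<^sup>)\<close>. By cofactor expansion of the inverse,
  the conjugate of \<open>\<phi>\<^bsub>2,-a\<^esub>\<close> is the determinant of \<open>g\<^bsup>[l+1]\<^esup>\<close> with row \<open>l\<^bsub>-a\<^esub>\<close> replaced by these powers,
  divided by \<open>\<tau>\<^bsup>(l+1)\<^esup>\<close> (\<open>cnj_phi2_minus_eq_det\<close>); by a Schur complement, the conjugate of \<open>\<phi>\<^bsub>2,+a\<^esub>\<close> is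
  the determinant of \<open>g\<^bsup>[l]\<^esup>\<close> bordered by the column of index \<open>l\<^bsub>+a\<^esub>\<close> and a last row of powers, divided
  by \<open>\<tau>\<^bsup>(l)\<^esup>\<close> (\<open>cnj_phi2_plus_eq_det\<close>).

  In both cases the exponents of the columns fill an interval of integers, and the last column
  carries an end of it. If this is the maximum, subtract from every other column \<open>x\<^sup>-\<^sup>1\<close> times the
  column whose exponent is larger by one. In the row of powers only the last entry survives, and an
  entry \<open>c (e i - e j)\<close> becomes \<open>c (e i - e j) - x\<^sup>-\<^sup>1 c (e i - e j - 1)\<close>, which is the moment of
  \<open>(1 - x\<^sup>-\<^sup>1 / u) d\<mu>(t)\<close>. The determinant is therefore, up to sign, a power of \<open>x\<close> times a minor of the moment matrix
  at the Miwa shift \<open>t + [x\<^sup>-\<^sup>1]\<^sub>2\<close>. If the last column carries the minimum, the reflection \<open>k \<mapsto> -k\<close>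
  leads to \<open>t - [x]\<^sub>1\<close> in the same way (\<open>det_power_row_max\<close>, \<open>det_power_row_min\<close>).

  Three ingredients remain. That a density multiplies the integrand, so that the moments of a Miwa
  shift are the stated combinations, is \<open>cm_integral_density\<close>. That the first \<open>l\<close> exponents fill an
  interval whose ends are counted by \<open>\<nu>\<^sub>+\<close> and \<open>\<nu>\<^sub>-\<close> is \<open>chi_exp_bij_betw_interval\<close>; it also identifies
  \<open>g\<^bsup>[l]\<^esup>\<close> with a reordered Toeplitz matrix, which makes all the \<open>\<tau>\<^bsup>(l)\<^esup>\<close> non-zero. The Gauss--Borel
  factors are triangular, so truncation to leading blocks respects the factorization; this gives
  \<open>(S\<^sub>2)\<^sub>l\<^sub>l = \<tau>\<^bsup>(l+1)\<^esup> / \<tau>\<^bsup>(l)\<^esup>\<close> and shows that column \<open>l\<close> of \<open>S\<^sub>2\<^sup>-\<^sup>1\<close> is the last column of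
  \<open>(g\<^bsup>[l+1]\<^esup>)\<^sup>-\<^sup>1\<close>, hence that \<open>\<phi>\<^sub>2\<close> coincides with \<open>\<phi>\<^bsub>2,-a(l)\<^esub>\<close>.
\<close>


section \<open>Complex measures and their densities\<close>

definition signed_measure :: "(complex set \<Rightarrow> real) \<Rightarrow> bool" where
  "signed_measure \<rho> \<longleftrightarrow>
     (\<forall>A :: nat \<Rightarrow> complex set. range A \<subseteq> sets circle_borel \<longrightarrow> disjoint_family A \<longrightarrow>
        (\<lambda>i. \<rho> (A i)) sums \<rho> (\<Union>i. A i))"

lemma signed_measureD:
  "signed_measure \<rho> \<Longrightarrow> range A \<subseteq> sets circle_borel \<Longrightarrow> disjoint_family A \<Longrightarrow>
    (\<lambda>i. \<rho> (A i)) sums \<rho> (\<Union>i. A i)" for A :: "nat \<Rightarrow> complex set"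
  by (auto simp: signed_measure_def)

lemma complex_measure_signed:
  assumes "complex_measure \<mu>"
  shows "signed_measure (\<lambda>A. Re (\<mu> A))" "signed_measure (\<lambda>A. - Re (\<mu> A))"
    "signed_measure (\<lambda>A. Im (\<mu> A))" "signed_measure (\<lambda>A. - Im (\<mu> A))"
  using assms unfolding complex_measure_def signed_measure_def
  by (auto intro!: sums_minus sums_Re sums_Im)

lemma space_circle_borel [simp]: "space circle_borel = circle"
  by (simp add: space_restrict_space)

lemma space_pos_variation [simp]: "space (pos_variation \<rho>) = circle"
  unfolding pos_variation_def using circle_sets by (rule space_measure_of)

lemma sets_pos_variation: "sets (pos_variation \<rho>) = sets circle_borel"
  unfolding pos_variation_def using circle_sets sets.sigma_sets_eq[of circle_borel]
  by (simp add: sets_measure_of)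

lemma borel_measurable_pos_variation:
  "borel_measurable (pos_variation \<rho>) = borel_measurable circle_borel"
  by (rule measurable_cong_sets[OF sets_pos_variation refl])

lemma emeasure_pos_variation_signed:
  assumes "signed_measure \<rho>" and "A \<in> sets circle_borel"
  shows "emeasure (pos_variation \<rho>) A = (SUP B\<in>{B \<in> sets circle_borel. B \<subseteq> A}. ennreal (\<rho> B))"
  by (intro emeasure_pos_variation signed_measureD assms)

lemma finite_pos_variation:
  assumes "signed_measure \<rho>"
  shows "finite_measure (pos_variation \<rho>)"
proof -
  note ca = signed_measureD[OF assms]
  obtain C where C: "\<And>B. B \<in> sets circle_borel \<Longrightarrow> \<bar>\<rho> B\<bar> \<le> C"
    using signed_bounded[of \<rho>] ca by blast
  have "circle \<in> sets circle_borel"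
    using sets.top[of circle_borel] unfolding space_circle_borel .
  then have "emeasure (pos_variation \<rho>) circle
      = (SUP B\<in>{B \<in> sets circle_borel. B \<subseteq> circle}. ennreal (\<rho> B))"
    by (rule emeasure_pos_variation_signed[OF assms])
  also have "\<dots> \<le> ennreal C"
    by (rule SUP_least) (use C in \<open>auto intro!: ennreal_leI simp: abs_le_iff\<close>)
  finally show ?thesis
    by (intro finite_measureI) (auto simp: top_unique)
qed

lemma signed_measure_uminus: "signed_measure \<rho> \<Longrightarrow> signed_measure (\<lambda>A. - \<rho> A)"
  unfolding signed_measure_def by (auto intro: sums_minus)

text \<open>The positive variation of \<open>\<rho>\<close> is a supremum over measurable subsets \<open>B\<close> of \<open>A\<close>, and
  \<open>\<rho> B = \<rho> A - \<rho> (A - B)\<close>; passing to complements turns the supremum of \<open>\<rho>\<close> into that of \<open>-\<rho>\<close>,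
  shifted by \<open>\<rho> A\<close>.\<close>

lemma jordan_decomposition:
  assumes \<rho>: "signed_measure \<rho>" and A: "A \<in> sets circle_borel"
  shows "measure (pos_variation \<rho>) A - measure (pos_variation (\<lambda>A. - \<rho> A)) A = \<rho> A"
proof -
  have upper: "\<sigma> B \<le> measure (pos_variation \<sigma>) A"
    if \<sigma>: "signed_measure \<sigma>" and B: "B \<in> sets circle_borel" "B \<subseteq> A" for \<sigma> B
  proof -
    have "ennreal (\<sigma> B) \<le> emeasure (pos_variation \<sigma>) A"
      unfolding emeasure_pos_variation_signed[OF \<sigma> A]
      by (rule SUP_upper) (use B in simp)
    also have "\<dots> = ennreal (measure (pos_variation \<sigma>) A)"
      by (rule finite_measure.emeasure_eq_measure[OF finite_pos_variation[OF \<sigma>]])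
    finally show ?thesis by (simp add: ennreal_le_iff)
  qed
  have least: "measure (pos_variation \<sigma>) A \<le> c"
    if \<sigma>: "signed_measure \<sigma>" and c: "\<And>B. B \<in> sets circle_borel \<Longrightarrow> B \<subseteq> A \<Longrightarrow> \<sigma> B \<le> c" for \<sigma> c
  proof -
    have "0 \<le> c"
      using c[of "{}"] signed_empty[of \<sigma>, OF signed_measureD[OF \<sigma>]] by simp
    have "emeasure (pos_variation \<sigma>) A \<le> ennreal c"
      unfolding emeasure_pos_variation_signed[OF \<sigma> A]
      by (rule SUP_least) (use c in \<open>auto intro: ennreal_leI\<close>)
    then show ?thesis
      unfolding finite_measure.emeasure_eq_measure[OF finite_pos_variation[OF \<sigma>]]
      using \<open>0 \<le> c\<close> by simp
  qed
  note neg = signed_measure_uminus[OF \<rho>]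
  have split: "\<rho> A = \<rho> B + \<rho> (A - B)" if B: "B \<in> sets circle_borel" "B \<subseteq> A" for B
    using signed_Un[of \<rho> B "A - B", OF signed_measureD[OF \<rho>]] that A
    by (simp add: Un_absorb1)
  have "\<rho> B \<le> \<rho> A + measure (pos_variation (\<lambda>A. - \<rho> A)) A"
    if B: "B \<in> sets circle_borel" "B \<subseteq> A" for B
    using upper[OF neg, of "A - B"] split[OF B] A B by auto
  then have 1: "measure (pos_variation \<rho>) A \<le> \<rho> A + measure (pos_variation (\<lambda>A. - \<rho> A)) A"
    by (rule least[OF \<rho>])
  have "- \<rho> B \<le> measure (pos_variation \<rho>) A - \<rho> A"
    if B: "B \<in> sets circle_borel" "B \<subseteq> A" for B
    using upper[OF \<rho>, of "A - B"] split[OF B] A B by auto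
  then have 2: "measure (pos_variation (\<lambda>A. - \<rho> A)) A \<le> measure (pos_variation \<rho>) A - \<rho> A"
    by (rule least[OF neg])
  from 1 2 show ?thesis by simp
qed

lemma cm_integral_indicator:
  assumes \<mu>: "complex_measure \<mu>" and A: "A \<in> sets circle_borel"
  shows "cm_integral \<mu> (indicator A) = \<mu> A"
proof -
  note s = complex_measure_signed[OF \<mu>]
  have int: "integral\<^sup>L (pos_variation \<sigma>) (indicator A :: complex \<Rightarrow> complex) =
      of_real (measure (pos_variation \<sigma>) A)" if \<sigma>: "signed_measure \<sigma>" for \<sigma>
  proof -
    have "A \<inter> circle = A" using A circle_sets by auto
    then show ?thesis
      using integral_complex_of_real[of "pos_variation \<sigma>" "indicator A"] by (simp add: of_real_indicator)
  qed
  have "cm_integral \<mu> (indicator A) = of_real (Re (\<mu> A)) + \<i> * of_real (Im (\<mu> A))"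
    unfolding cm_integral_def int[OF s(1)] int[OF s(2)] int[OF s(3)] int[OF s(4)]
    using jordan_decomposition[OF s(1) A] jordan_decomposition[OF s(3) A]
    by (simp flip: of_real_diff)
  then show ?thesis using complex_eq[of "\<mu> A"] by simp
qed

lemma cm_integral_cong:
  assumes "\<And>u. u \<in> circle \<Longrightarrow> f u = h u"
  shows "cm_integral \<mu> f = cm_integral \<mu> h"
proof -
  have "integral\<^sup>L (pos_variation \<sigma>) f = integral\<^sup>L (pos_variation \<sigma>) h" for \<sigma>
    by (rule Bochner_Integration.integral_cong) (simp_all add: assms)
  then show ?thesis by (simp add: cm_integral_def)
qed

lemma cm_integral_diff:
  "cm_integrable \<mu> f \<Longrightarrow> cm_integrable \<mu> h \<Longrightarrow>
    cm_integral \<mu> (\<lambda>u. f u - h u) = cm_integral \<mu> f - cm_integral \<mu> h"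
  by (simp add: cm_integral_def cm_integrable_def algebra_simps)

lemma cm_integral_cmult: "cm_integral \<mu> (\<lambda>u. c * f u) = c * cm_integral \<mu> f"
  by (simp add: cm_integral_def algebra_simps)

lemma cm_integral_sum:
  "(\<And>i. i \<in> I \<Longrightarrow> cm_integrable \<mu> (f i)) \<Longrightarrow>
    cm_integral \<mu> (\<lambda>u. \<Sum>i\<in>I. f i u) = (\<Sum>i\<in>I. cm_integral \<mu> (f i))"
  by (simp add: cm_integral_def cm_integrable_def sum.distrib sum_subtractf flip: sum_distrib_left)

lemma cm_integrable_measurable: "cm_integrable \<mu> h \<Longrightarrow> h \<in> borel_measurable circle_borel"
  unfolding cm_integrable_def using borel_measurable_integrable borel_measurable_pos_variation by blast

lemma cm_integrable_mult_bounded: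
  assumes h: "cm_integrable \<mu> h"
    and f: "f \<in> borel_measurable circle_borel" and b: "\<And>u. u \<in> circle \<Longrightarrow> norm (f u) \<le> K"
  shows "cm_integrable \<mu> (\<lambda>u. f u * h u)"
proof -
  have "integrable (pos_variation \<sigma>) (\<lambda>u. f u * h u)"
    if "integrable (pos_variation \<sigma>) h" for \<sigma>
  proof (rule Bochner_Integration.integrable_bound)
    show "integrable (pos_variation \<sigma>) (\<lambda>u. complex_of_real K * h u)"
      using that by simp
    show "(\<lambda>u. f u * h u) \<in> borel_measurable (pos_variation \<sigma>)"
      using f cm_integrable_measurable[OF h] unfolding borel_measurable_pos_variation
      by (rule borel_measurable_times)
    have "norm (f u) * norm (h u) \<le> \<bar>K\<bar> * norm (h u)" if "u \<in> circle" for u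
      using b[OF that] by (intro mult_right_mono) auto
    then show "AE u in pos_variation \<sigma>. norm (f u * h u) \<le> norm (complex_of_real K * h u)"
      by (intro AE_I2) (simp add: norm_mult)
  qed
  with h show ?thesis by (simp add: cm_integrable_def)
qed

lemma cm_integral_dominated_convergence:
  assumes h: "cm_integrable \<mu> h"
    and s: "\<And>n. s n \<in> borel_measurable circle_borel"
    and f: "f \<in> borel_measurable circle_borel"
    and b: "\<And>n u. u \<in> circle \<Longrightarrow> norm (s n u) \<le> norm (h u)"
    and lim: "\<And>u. u \<in> circle \<Longrightarrow> (\<lambda>n. s n u) \<longlonglongrightarrow> f u"
  shows "(\<lambda>n. cm_integral \<mu> (s n)) \<longlonglongrightarrow> cm_integral \<mu> f"
proof -
  have "(\<lambda>n. integral\<^sup>L (pos_variation \<sigma>) (s n)) \<longlonglongrightarrow> integral\<^sup>L (pos_variation \<sigma>) f"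
    if "integrable (pos_variation \<sigma>) h" for \<sigma>
  proof (rule integral_dominated_convergence)
    show "integrable (pos_variation \<sigma>) (\<lambda>u. norm (h u))"
      using that by (rule integrable_norm)
    show "f \<in> borel_measurable (pos_variation \<sigma>)" "s n \<in> borel_measurable (pos_variation \<sigma>)" for n
      unfolding borel_measurable_pos_variation by (rule f s)+
  qed (use b lim in auto)
  with h show ?thesis
    unfolding cm_integral_def cm_integrable_def by (intro tendsto_intros) auto
qed

text \<open>Countable additivity is dominated convergence along the partial unions, with \<open>h\<close> as the dominating
  function.\<close>

lemma complex_measure_density:
  assumes h: "cm_integrable \<mu> h"
  shows "complex_measure (cm_density h \<mu>)"
  unfolding complex_measure_def
proof (intro allI impI)
  fix A :: "nat \<Rightarrow> complex set"
  assume A: "range A \<subseteq> sets circle_borel" and dis: "disjoint_family A"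
  have meas: "(\<lambda>u. indicator B u * h u) \<in> borel_measurable circle_borel"
    if "B \<in> sets circle_borel" for B
    using that cm_integrable_measurable[OF h] by simp
  have sum_ind: "(\<Sum>i<n. indicator (A i) u) = (indicator (\<Union>i<n. A i) u :: complex)" for n u
    using dis by (intro indicator_UN_disjoint[symmetric] disjoint_family_on_mono[OF _ dis]) auto
  have "(\<lambda>n. cm_integral \<mu> (\<lambda>u. indicator (\<Union>i<n. A i) u * h u)) \<longlonglongrightarrow>
      cm_integral \<mu> (\<lambda>u. indicator (\<Union>i. A i) u * h u)"
  proof (rule cm_integral_dominated_convergence[OF h])
    show "(\<lambda>n. indicator (\<Union>i<n. A i) u * h u) \<longlonglongrightarrow> indicator (\<Union>i. A i) u * h u" for u
      by (intro tendsto_mult LIMSEQ_indicator_UN tendsto_const)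
    show "norm (indicator (\<Union>i<n. A i) u * h u) \<le> norm (h u)" for n u
      by (simp add: indicator_def norm_mult)
  qed (use A in \<open>auto intro!: meas\<close>)
  also have "(\<lambda>n. cm_integral \<mu> (\<lambda>u. indicator (\<Union>i<n. A i) u * h u)) =
      (\<lambda>n. \<Sum>i<n. cm_density h \<mu> (A i))"
  proof
    fix n
    have "cm_integral \<mu> (\<lambda>u. indicator (\<Union>i<n. A i) u * h u) =
        cm_integral \<mu> (\<lambda>u. \<Sum>i<n. indicator (A i) u * h u)"
      by (simp add: sum_ind flip: sum_distrib_right)
    also have "\<dots> = (\<Sum>i<n. cm_density h \<mu> (A i))"
      unfolding cm_density_def using A
      by (intro cm_integral_sum cm_integrable_mult_bounded[OF h, of _ 1]) (auto simp: indicator_def)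
    finally show "cm_integral \<mu> (\<lambda>u. indicator (\<Union>i<n. A i) u * h u) =
        (\<Sum>i<n. cm_density h \<mu> (A i))" .
  qed
  finally show "(\<lambda>i. cm_density h \<mu> (A i)) sums cm_density h \<mu> (\<Union>i. A i)"
    by (simp add: sums_def cm_density_def)
qed

text \<open>For indicator functions \<open>f\<close> this is the definition of the density. It extends to simple functions
  by linearity and to bounded measurable ones by dominated convergence on both sides.\<close>

lemma cm_integral_density:
  assumes h: "cm_integrable \<mu> h"
    and f: "f \<in> borel_measurable circle_borel" and b: "\<And>u. u \<in> circle \<Longrightarrow> norm (f u) \<le> K"
  shows "cm_integral (cm_density h \<mu>) f = cm_integral \<mu> (\<lambda>u. f u * h u)"
proof -
  let ?\<nu> = "cm_density h \<mu>"
  have \<nu>: "complex_measure ?\<nu>" by (rule complex_measure_density[OF h])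
  have ind: "(\<lambda>u. y * indicator B u) \<in> borel_measurable circle_borel"
      "norm (y * indicator B u) \<le> norm y"
    if "B \<in> sets circle_borel" for y :: complex and B u
    using that by (intro borel_measurable_times borel_measurable_const borel_measurable_indicator)
      (auto simp: indicator_def)
  have simple: "cm_integral ?\<nu> s = cm_integral \<mu> (\<lambda>u. s u * h u)"
    if s: "simple_function circle_borel s" for s
  proof -
    let ?V = "s ` circle" and ?S = "\<lambda>y. s -` {y} \<inter> circle"
    have fin: "finite ?V" and S: "?S y \<in> sets circle_borel" for y
      using simple_functionD[OF s] by simp_all
    have rep: "s u = (\<Sum>y\<in>?V. y * indicator (?S y) u)" if u: "u \<in> circle" for u
    proof -
      have "(\<Sum>y\<in>?V. y * indicator (?S y) u) = (\<Sum>y\<in>?V. if y = s u then y else 0)"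
        using u by (intro sum.cong) (auto simp: indicator_def)
      then show ?thesis using fin u by simp
    qed
    have "cm_integral ?\<nu> s = cm_integral ?\<nu> (\<lambda>u. \<Sum>y\<in>?V. y * indicator (?S y) u)"
      by (rule cm_integral_cong) (rule rep)
    also have "\<dots> = (\<Sum>y\<in>?V. cm_integral ?\<nu> (\<lambda>u. y * indicator (?S y) u))"
    proof (rule cm_integral_sum)
      fix y :: complex
      show "cm_integrable ?\<nu> (\<lambda>u. y * indicator (?S y) u)"
        by (rule complex_measure_integrable[OF \<nu> ind[OF S]])
    qed
    also have "\<dots> = (\<Sum>y\<in>?V. y * cm_density h \<mu> (?S y))"
      using cm_integral_indicator[OF \<nu> S] by (simp add: cm_integral_cmult)
    also have "\<dots> = (\<Sum>y\<in>?V. cm_integral \<mu> (\<lambda>u. y * (indicator (?S y) u * h u)))"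
      by (simp add: cm_integral_cmult cm_density_def)
    also have "\<dots> = cm_integral \<mu> (\<lambda>u. \<Sum>y\<in>?V. y * (indicator (?S y) u * h u))"
    proof (rule cm_integral_sum[symmetric])
      fix y :: complex
      have "cm_integrable \<mu> (\<lambda>u. (y * indicator (?S y) u) * h u)"
        by (rule cm_integrable_mult_bounded[OF h ind[OF S]])
      then show "cm_integrable \<mu> (\<lambda>u. y * (indicator (?S y) u * h u))"
        by (simp add: mult.assoc)
    qed
    also have "\<dots> = cm_integral \<mu> (\<lambda>u. s u * h u)"
      by (rule cm_integral_cong) (subst rep, auto simp: sum_distrib_right mult.assoc)
    finally show ?thesis .
  qed
  obtain F where F: "\<And>i. simple_function circle_borel (F i)"
      "\<And>u. u \<in> circle \<Longrightarrow> (\<lambda>i. F i u) \<longlonglongrightarrow> f u"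
      "\<And>i u. u \<in> circle \<Longrightarrow> norm (F i u) \<le> 2 * norm (f u)"
    using borel_measurable_implies_sequence_metric[OF f, of 0]
    unfolding space_circle_borel dist_0_norm dist_norm diff_zero by blast
  have FK: "norm (F i u) \<le> 2 * K" if "u \<in> circle" for i u
    using F(3)[OF that, of i] b[OF that] by linarith
  note Fm = borel_measurable_simple_function[OF F(1)]
  have K: "0 \<le> K" using b[of 1] norm_ge_zero[of "f 1"] by (simp del: norm_ge_zero)
  have "(\<lambda>i. cm_integral ?\<nu> (F i)) \<longlonglongrightarrow> cm_integral ?\<nu> f"
  proof (rule cm_integral_dominated_convergence)
    show "cm_integrable ?\<nu> (\<lambda>_. of_real (2 * K))"
      by (rule complex_measure_integrable[OF \<nu>, of _ "2 * K"]) (use K in auto)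
  qed (use f F FK K Fm in auto)
  moreover have "(\<lambda>i. cm_integral \<mu> (\<lambda>u. F i u * h u)) \<longlonglongrightarrow> cm_integral \<mu> (\<lambda>u. f u * h u)"
  proof (rule cm_integral_dominated_convergence)
    show "cm_integrable \<mu> (\<lambda>u. of_real (2 * K) * h u)"
      by (rule cm_integrable_mult_bounded[OF h, of _ "2 * K"]) (use K in auto)
    show "norm (F i u * h u) \<le> norm (of_real (2 * K) * h u)" if "u \<in> circle" for i u
      using FK[OF that, of i] K by (simp add: norm_mult mult_right_mono)
    show "(\<lambda>i. F i u * h u) \<longlonglongrightarrow> f u * h u" if "u \<in> circle" for u
      using F(2)[OF that] by (intro tendsto_intros)
  qed (use f Fm cm_integrable_measurable[OF h] in \<open>auto intro: borel_measurable_times\<close>)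
  ultimately show ?thesis
    unfolding simple[OF F(1)] by (rule LIMSEQ_unique)
qed


section \<open>Moments\<close>

lemma borel_measurable_powi_circle: "(\<lambda>u. u powi k) \<in> borel_measurable circle_borel"
proof (rule borel_measurable_continuous_on_restrict)
  show "continuous_on circle (\<lambda>u. u powi k)" by (intro continuous_intros) auto
qed

lemma norm_powi_circle: "u \<in> circle \<Longrightarrow> norm (u powi k) = 1"
  by (simp add: norm_power_int)

definition moment :: "(complex set \<Rightarrow> complex) \<Rightarrow> int \<Rightarrow> complex" where
  "moment \<mu> k = cm_integral \<mu> (\<lambda>u. u powi k)"

lemma cnj_powi_circle:
  assumes "u \<in> circle"
  shows "cnj u powi k = u powi (- k)"
proof -
  have "u * cnj u = 1"
    using assms by (simp add: complex_norm_square[symmetric])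
  then have "cnj u = inverse u" by (rule inverse_unique[symmetric])
  then show ?thesis
    by (simp add: power_int_minus power_int_inverse)
qed

lemma moment_matrix_eq_moment:
  "moment_matrix np nm \<mu> i j = moment \<mu> (chi_exp np nm i - chi_exp np nm j)"
  unfolding moment_matrix_def moment_def
proof (rule cm_integral_cong)
  fix u :: complex assume u: "u \<in> circle"
  then have "u \<noteq> 0" by auto
  then show "chi np nm i u * cnj (chi np nm j u) = u powi (chi_exp np nm i - chi_exp np nm j)"
    by (simp add: chi_def cnj_powi_circle[OF u] power_int_diff power_int_minus divide_inverse)
qed

lemma moment_density_linear:
  assumes \<nu>: "complex_measure \<nu>"
  shows "moment (cm_density (\<lambda>u. 1 - w * u powi m) \<nu>) k = moment \<nu> k - w * moment \<nu> (k + m)"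
proof -
  have int: "cm_integrable \<nu> (\<lambda>u. u powi k)" for k
    by (rule complex_measure_integrable[OF \<nu> borel_measurable_powi_circle, where K = 1]) (simp add: norm_powi_circle)
  have "cm_integrable \<nu> (\<lambda>u. w * u powi k)" for k
    using borel_measurable_powi_circle[of k]
    by (intro complex_measure_integrable[OF \<nu>, of _ "norm w"]) (auto simp: norm_mult norm_powi_circle)
  note int = int this
  have h: "cm_integrable \<nu> (\<lambda>u. 1 - w * u powi m)"
  proof (rule complex_measure_integrable[OF \<nu>])
    show "norm (1 - w * u powi m) \<le> 1 + norm w" if "u \<in> circle" for u
      using norm_triangle_ineq4[of 1 "w * u powi m"] by (simp add: norm_mult norm_powi_circle[OF that])
  qed (use borel_measurable_powi_circle[of m] in auto)
  have "moment (cm_density (\<lambda>u. 1 - w * u powi m) \<nu>) k = cm_integral \<nu> (\<lambda>u. u powi k * (1 - w * u powi m))"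
    unfolding moment_def
    by (rule cm_integral_density[OF h borel_measurable_powi_circle, where K = 1]) (simp add: norm_powi_circle)
  also have "\<dots> = cm_integral \<nu> (\<lambda>u. u powi k - w * u powi (k + m))"
  proof (rule cm_integral_cong)
    fix u :: complex assume "u \<in> circle"
    then have "u \<noteq> 0" by auto
    then show "u powi k * (1 - w * u powi m) = u powi k - w * u powi (k + m)"
      by (simp add: power_int_add algebra_simps)
  qed
  also have "\<dots> = moment \<nu> k - w * moment \<nu> (k + m)"
    by (simp add: cm_integral_diff int cm_integral_cmult moment_def)
  finally show ?thesis .
qed

lemma moment_miwa_minus_1:
  assumes "complex_measure \<nu>"
  shows "moment (miwa_minus_1 w \<nu>) k = moment \<nu> k - w * moment \<nu> (k + 1)"
  using moment_density_linear[OF assms, of w 1 k] by (simp add: miwa_minus_1_def)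

lemma moment_miwa_plus_2:
  assumes "complex_measure \<nu>"
  shows "moment (miwa_plus_2 w \<nu>) k = moment \<nu> k - w * moment \<nu> (k - 1)"
  using moment_density_linear[OF assms, of w "-1" k] by (simp add: miwa_plus_2_def divide_inverse power_int_minus)


section \<open>The extended ordering\<close>

(* The kinds are the numbers 1 and 2; unfolding 1 to Suc 0 would hide them from the simplifier. *)
context
  notes One_nat_def [simp del]
begin

lemma chi_exp_nonneg_iff:
  assumes "np \<ge> 1"
  shows "chi_exp np nm l \<ge> 0 \<longleftrightarrow> l mod (np + nm) < np"
proof -
  have "\<not> 0 \<le> - int (k + 1)" for k by simp
  then show ?thesis
    unfolding chi_exp_def Let_def by (metis of_nat_0_le_iff)
qed

definition count_kind :: "nat \<Rightarrow> nat \<Rightarrow> nat \<Rightarrow> nat \<Rightarrow> nat" where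
  "count_kind np nm a l = card {k. k < l \<and> kind np nm k = a}"

lemma count_kind_0 [simp]: "count_kind np nm a 0 = 0"
  by (simp add: count_kind_def)

lemma count_kind_Suc:
  "count_kind np nm a (Suc l) = count_kind np nm a l + (if kind np nm l = a then 1 else 0)"
proof -
  have "{k. k < Suc l \<and> kind np nm k = a} =
    (if kind np nm l = a then insert l {k. k < l \<and> kind np nm k = a}
     else {k. k < l \<and> kind np nm k = a})"
    by (auto simp: less_Suc_eq)
  then show ?thesis by (simp add: count_kind_def)
qed

lemma kind_1_iff: "kind np nm l = 1 \<longleftrightarrow> chi_exp np nm l \<ge> 0"
  and kind_2_iff: "kind np nm l = 2 \<longleftrightarrow> chi_exp np nm l < 0"
  by (auto simp: kind_def)

text \<open>Each full round of the ordering contributes \<open>np\<close> non-negative and \<open>nm\<close> negative powers; within a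
  round the non-negative ones come first.\<close>

lemma count_kind_closed_form:
  fixes nm :: nat
  assumes "np \<ge> 1"
  defines "n \<equiv> np + nm"
  shows "count_kind np nm 1 l = l div n * np + min (l mod n) np \<and>
         count_kind np nm 2 l = l div n * nm + (l mod n - np)"
proof (induction l)
  case (Suc l)
  have k: "kind np nm l = 1 \<longleftrightarrow> l mod n < np" "kind np nm l = 2 \<longleftrightarrow> \<not> l mod n < np"
    using chi_exp_nonneg_iff[OF assms(1), of nm l] by (auto simp: kind_1_iff kind_2_iff n_def)
  have n: "n > 0" using assms by (simp add: n_def)
  then have ln: "l mod n < n" by simp
  show ?case
  proof (cases "Suc (l mod n) = n")
    case True
    then have "Suc l mod n = 0" "Suc l div n = Suc (l div n)"
      by (simp_all add: mod_Suc div_Suc)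
    with Suc True k ln show ?thesis by (auto simp: count_kind_Suc n_def algebra_simps)
  next
    case False
    then have "Suc l mod n = Suc (l mod n)" "Suc l div n = l div n"
      by (simp_all add: mod_Suc div_Suc)
    with Suc False k ln show ?thesis by (auto simp: count_kind_Suc)
  qed
qed simp

text \<open>The monomials of each kind are listed by increasing absolute value of the exponent, without gaps;
  so the exponent of a monomial is determined by how many monomials of its kind precede it.\<close>

lemma chi_exp_eq_count:
  assumes "np \<ge> 1"
  shows "kind np nm l = 1 \<Longrightarrow> chi_exp np nm l = int (count_kind np nm 1 l)"
    and "kind np nm l = 2 \<Longrightarrow> chi_exp np nm l = - int (count_kind np nm 2 l) - 1"
proof -
  note c = count_kind_closed_form[OF assms, of nm l]
  show "kind np nm l = 1 \<Longrightarrow> chi_exp np nm l = int (count_kind np nm 1 l)"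
    using c chi_exp_nonneg_iff[OF assms, of nm l] unfolding kind_1_iff
    by (simp add: chi_exp_def Let_def)
  show "kind np nm l = 2 \<Longrightarrow> chi_exp np nm l = - int (count_kind np nm 2 l) - 1"
    using c chi_exp_nonneg_iff[OF assms, of nm l] unfolding kind_2_iff
    by (simp add: chi_exp_def Let_def not_le[symmetric] split: if_splits)
qed

text \<open>A new monomial extends the interval of exponents by one, on the right or on the left according to
  its kind.\<close>

lemma chi_exp_bij_betw_interval:
  assumes "np \<ge> 1"
  shows "bij_betw (chi_exp np nm) {..<l} {- int (count_kind np nm 2 l)..<int (count_kind np nm 1 l)}"
proof (induction l)
  case (Suc l)
  let ?a = "- int (count_kind np nm 2 l)" and ?b = "int (count_kind np nm 1 l)"
  have k: "kind np nm l = 1 \<or> kind np nm l = 2" by (simp add: kind_def)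
  let ?e = "chi_exp np nm l"
  have e: "kind np nm l = 1 \<and> ?e = ?b \<or> kind np nm l = 2 \<and> ?e = ?a - 1"
    using k chi_exp_eq_count[OF assms, of nm l] by auto
  have I: "{- int (count_kind np nm 2 (Suc l))..<int (count_kind np nm 1 (Suc l))} = insert ?e {?a..<?b}"
    using e by (auto simp: count_kind_Suc)
  have "?e \<notin> {?a..<?b}" using e by auto
  then have "bij_betw (chi_exp np nm) ({..<l} \<union> {l}) ({?a..<?b} \<union> {?e})"
    using Suc by (intro bij_betw_combine) auto
  then show ?case unfolding I by (simp add: lessThan_Suc)
qed (simp add: bij_betw_def)

lemma nu_eq_count:
  "nu_plus np nm l = count_kind np nm 1 (Suc l)" "nu_minus np nm l = count_kind np nm 2 (Suc l)"
  by (simp_all add: nu_plus_def nu_minus_def count_kind_def less_Suc_eq_le)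

lemma chi_exp_nu:
  assumes "np \<ge> 1"
  shows "kind np nm l = 1 \<Longrightarrow> chi_exp np nm l = int (nu_plus np nm l) - 1"
    and "kind np nm l = 2 \<Longrightarrow> chi_exp np nm l = - int (nu_minus np nm l)"
  using chi_exp_eq_count[OF assms, of nm l] by (auto simp: nu_eq_count count_kind_Suc)

text \<open>Both kinds occur in every round of the ordering, so that \<open>l\<^bsub>+a\<^esub>\<close> always exists and \<open>l\<^bsub>-a\<^esub>\<close> exists
  after one full round.\<close>

lemma ex_kind:
  assumes "np \<ge> 1" "nm \<ge> 1" "a = 1 \<or> a = 2"
  shows "\<exists>r<np + nm. \<forall>q. kind np nm (q * (np + nm) + r) = a"
  using assms(3)
proof
  assume "a = 1"
  then show ?thesis using assms
    by (intro exI[of _ 0]) (auto simp: kind_1_iff chi_exp_nonneg_iff)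
next
  assume a: "a = 2"
  have "\<not> chi_exp np nm (q * (np + nm) + np) \<ge> 0" for q
    unfolding chi_exp_nonneg_iff[OF assms(1)] using assms by simp
  with a show ?thesis using assms by (intro exI[of _ np]) (auto simp: kind_2_iff not_le)
qed

lemma next_index_props:
  assumes "np \<ge> 1" "nm \<ge> 1" "a = 1 \<or> a = 2"
  shows "next_index np nm a l \<ge> l" "kind np nm (next_index np nm a l) = a"
    "l \<le> k \<Longrightarrow> k < next_index np nm a l \<Longrightarrow> kind np nm k \<noteq> a"
proof -
  obtain r where r: "\<And>q. kind np nm (q * (np + nm) + r) = a"
    using ex_kind[OF assms] by blast
  have "l * 1 \<le> l * (np + nm)" by (rule mult_le_mono2) (use assms in simp)
  then have "l \<le> l * (np + nm) + r" by linarith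
  then have "l \<le> l * (np + nm) + r \<and> kind np nm (l * (np + nm) + r) = a"
    using r by blast
  from LeastI[of "\<lambda>k. l \<le> k \<and> kind np nm k = a", OF this]
  show "next_index np nm a l \<ge> l" "kind np nm (next_index np nm a l) = a"
    by (auto simp: next_index_def)
  show "l \<le> k \<Longrightarrow> k < next_index np nm a l \<Longrightarrow> kind np nm k \<noteq> a"
    unfolding next_index_def by (drule not_less_Least) auto
qed

lemma next_index_self: "kind np nm l = a \<Longrightarrow> next_index np nm a l = l"
  unfolding next_index_def by (rule Least_equality) auto

lemma prev_index_self: "kind np nm l = a \<Longrightarrow> prev_index np nm a l = l"
  unfolding prev_index_def by (rule Greatest_equality) auto

lemma prev_index_le:
  assumes "np \<ge> 1" "nm \<ge> 1" "a = 1 \<or> a = 2" "l \<ge> np + nm"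
  shows "prev_index np nm a l \<le> l"
proof -
  obtain r where r: "r < np + nm" "\<And>q. kind np nm (q * (np + nm) + r) = a"
    using ex_kind[OF assms(1-3)] by blast
  have "r \<le> l \<and> kind np nm r = a" using r(1) r(2)[of 0] assms(4) by simp
  from GreatestI_nat[of "\<lambda>k. k \<le> l \<and> kind np nm k = a", OF this, of l]
  show ?thesis by (simp add: prev_index_def)
qed

text \<open>No monomial of kind \<open>a\<close> occurs between position \<open>l\<close> and position \<open>l\<^bsub>+a\<^esub>\<close>, so the exponent at
  \<open>l\<^bsub>+a\<^esub>\<close> continues the interval of the first \<open>l\<close> exponents.\<close>

lemma chi_exp_next_index:
  assumes "np \<ge> 1" "nm \<ge> 1"
  shows "chi_exp np nm (next_index np nm 1 l) = int (count_kind np nm 1 l)"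
    and "chi_exp np nm (next_index np nm 2 l) = - int (count_kind np nm 2 l) - 1"
proof -
  have *: "count_kind np nm a (next_index np nm a l) = count_kind np nm a l" if a: "a = 1 \<or> a = 2" for a
  proof -
    have "{k. k < next_index np nm a l \<and> kind np nm k = a} = {k. k < l \<and> kind np nm k = a}"
      using next_index_props(1)[OF assms a, of l] next_index_props(3)[OF assms a, of l]
      by (metis (no_types, lifting) not_le order_less_le_trans)
    then show ?thesis by (simp add: count_kind_def)
  qed
  show "chi_exp np nm (next_index np nm 1 l) = int (count_kind np nm 1 l)"
    using chi_exp_eq_count(1)[OF assms(1) next_index_props(2)[OF assms, of 1 l]] by (simp add: *)
  show "chi_exp np nm (next_index np nm 2 l) = - int (count_kind np nm 2 l) - 1"
    using chi_exp_eq_count(2)[OF assms(1) next_index_props(2)[OF assms, of 2 l]] by (simp add: *)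
qed
end


section \<open>Determinants with a row of powers\<close>

lemma det_simultaneous_permute:
  fixes A :: "'a :: comm_ring_1 mat"
  assumes A: "A \<in> carrier_mat n n" and p: "p permutes {0..<n}"
  shows "det (mat n n (\<lambda>(i, j). A $$ (p i, p j))) = det A"
proof -
  let ?B = "mat n n (\<lambda>(i, j). A $$ (p i, j))"
  have "det (mat n n (\<lambda>(i, j). A $$ (p i, p j))) = det (mat n n (\<lambda>(i, j). ?B\<^sup>T $$ (p i, j)))\<^sup>T"
    using permutes_in_image[OF p] by (intro arg_cong[of _ _ det] eq_matI) auto
  also have "\<dots> = det (mat n n (\<lambda>(i, j). ?B\<^sup>T $$ (p i, j)))"
    by (rule det_transpose[of _ n]) simp
  also have "\<dots> = signof p * det ?B\<^sup>T"
    by (rule det_permute_rows[OF _ p]) simp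
  also have "det ?B\<^sup>T = det ?B"
    by (rule det_transpose[of _ n]) simp
  also have "det ?B = signof p * det A"
    by (rule det_permute_rows[OF A p])
  also have "signof p * (signof p * det A) = det A"
    by (simp add: sign_def)
  finally show ?thesis .
qed

lemma interval_enumeration_permutes:
  fixes e :: "nat \<Rightarrow> int"
  assumes e: "bij_betw e {..<n} {a..<a + int n}"
  shows "\<exists>p. p permutes {0..<n} \<and> (\<forall>i<n. e i = a + int (p i))"
proof -
  define p where "p i = (if i < n then nat (e i - a) else i)" for i
  have in_I: "e i \<in> {a..<a + int n}" if "i < n" for i
    using bij_betw_apply[OF e] that by simp
  then have eq: "e i = a + int (p i)" if "i < n" for i
    using that by (force simp: p_def)
  have less: "p i < n" if "i < n" for i
    using in_I[OF that] eq[OF that] by simp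
  have "inj_on p {0..<n}"
    using bij_betw_imp_inj_on[OF e] eq by (auto simp: inj_on_def)
  then have "bij_betw p {0..<n} {0..<n}"
    using less by (intro bij_betw_imageI endo_inj_surj) auto
  then have "p permutes {0..<n}"
    by (rule bij_imp_permutes) (simp add: p_def)
  with eq show ?thesis by blast
qed

text \<open>Listing an interval in another order permutes rows and columns by the same permutation, whose sign
  enters twice.\<close>

lemma det_reindex_interval:
  fixes f :: "int \<Rightarrow> int \<Rightarrow> 'a :: comm_ring_1"
  assumes e: "bij_betw e {..<n} {a..<a + int n}"
  shows "det (mat n n (\<lambda>(i, j). f (e i) (e j))) = det (mat n n (\<lambda>(i, j). f (a + int i) (a + int j)))"
proof -
  obtain p where p: "p permutes {0..<n}" "\<And>i. i < n \<Longrightarrow> e i = a + int (p i)"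
    using interval_enumeration_permutes[OF e] by blast
  have "mat n n (\<lambda>(i, j). f (e i) (e j)) =
    mat n n (\<lambda>(i, j). mat n n (\<lambda>(i, j). f (a + int i) (a + int j)) $$ (p i, p j))"
    using permutes_in_image[OF p(1)] by (intro eq_matI) (auto simp: p(2))
  then show ?thesis
    using det_simultaneous_permute[OF _ p(1), of "mat n n (\<lambda>(i, j). f (a + int i) (a + int j))"]
    by simp
qed

text \<open>The matrix of the column operations that subtract \<open>w\<close> times the column with the next larger
  exponent. In the order of the exponents it is unitriangular; in the given order it need not be.\<close>

lemma det_shift_matrix:
  fixes w :: "'a :: comm_ring_1" and e :: "nat \<Rightarrow> int"
  assumes e: "bij_betw e {..<n} {a..<a + int n}"
  shows "det (mat n n (\<lambda>(k, j). if e k = e j then 1 else if e k = e j + 1 then - w else 0)) = 1"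
proof -
  let ?T = "mat n n (\<lambda>(k, j). if a + int k = a + int j then 1
      else if a + int k = a + int j + 1 then - w else 0)"
  have "det ?T = prod_list (diag_mat ?T)"
    by (rule det_lower_triangular[of n]) auto
  also have "diag_mat ?T = replicate n 1"
    unfolding diag_mat_def by (intro nth_equalityI) auto
  finally show ?thesis
    using det_reindex_interval[OF e, of "\<lambda>x y. if x = y then 1 else if x = y + 1 then - w else 0"]
    by simp
qed

text \<open>After the column operations with \<open>w = x\<^sup>-\<^sup>1\<close> row \<open>p\<close> vanishes except in column \<open>l\<close>, since
  \<open>x powi e j - inverse x * x powi (e j + 1) = 0\<close>. Column \<open>l\<close>, which carries the largest exponent, is left
  unchanged, and the expansion along row \<open>p\<close> has a single term.\<close>

lemma det_power_row_max:
  fixes F :: "nat \<Rightarrow> int \<Rightarrow> 'a :: field" and e :: "nat \<Rightarrow> int"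
  assumes e: "bij_betw e {..<Suc l} {a..<a + int (Suc l)}" and el: "e l = a + int l"
    and x: "x \<noteq> 0" and p: "p \<le> l"
  shows "det (mat (Suc l) (Suc l) (\<lambda>(i, j). if i = p then x powi e j else F i (e j))) =
    x powi e l * ((-1) ^ (p + l) *
      det (mat_delete (mat (Suc l) (Suc l) (\<lambda>(i, j). F i (e j) - inverse x * F i (e j + 1))) p l))"
    (is "det ?M = _ * (_ * det (mat_delete ?R p l))")
proof -
  let ?n = "Suc l"
  define U where "U = mat ?n ?n (\<lambda>(k, j). if e k = e j then 1 else if e k = e j + 1 then - inverse x else 0)"
  define N where "N = ?M * U"
  have M: "?M \<in> carrier_mat ?n ?n" and U: "U \<in> carrier_mat ?n ?n" by (simp_all add: U_def)
  from mult_carrier_mat[OF this] have N: "N \<in> carrier_mat ?n ?n" by (simp only: N_def)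
  have inj: "e i = e j \<longleftrightarrow> i = j" if "i < ?n" "j < ?n" for i j
    using bij_betw_imp_inj_on[OF e] that by (auto dest: inj_onD)
  have entry: "N $$ (i, j) = ?M $$ (i, j) - inverse x * (if i = p then x powi (e j + 1) else F i (e j + 1))"
    if i: "i < ?n" and j: "j < l" for i j
  proof -
    have "e j \<noteq> e l" using inj[of j l] j by simp
    then have "e j + 1 \<in> {a..<a + int ?n}"
      using bij_betw_apply[OF e, of j] j el by auto
    then obtain k where k: "k < ?n" "e k = e j + 1"
      using bij_betw_imp_surj_on[OF e] by (metis imageE lessThan_iff)
    then have kj: "k \<noteq> j" by auto
    have "N $$ (i, j) = (\<Sum>m<?n. ?M $$ (i, m) * U $$ (m, j))"
      using i j M U unfolding N_def by (simp add: scalar_prod_def lessThan_atLeast0)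
    also have "\<dots> = (\<Sum>m<?n. if m = j then ?M $$ (i, m) else if m = k then - inverse x * ?M $$ (i, m) else 0)"
    proof (intro sum.cong refl)
      fix m assume "m \<in> {..<?n}"
      then have "e m = e j \<longleftrightarrow> m = j" "e m = e j + 1 \<longleftrightarrow> m = k"
        using inj[of m j] inj[of m k] j k by auto
      then show "?M $$ (i, m) * U $$ (m, j) =
          (if m = j then ?M $$ (i, m) else if m = k then - inverse x * ?M $$ (i, m) else 0)"
        using \<open>m \<in> _\<close> j by (simp add: U_def)
    qed
    also have "\<dots> = (\<Sum>m\<in>{j, k}. if m = j then ?M $$ (i, m) else if m = k then - inverse x * ?M $$ (i, m) else 0)"
      using j k by (intro sum.mono_neutral_right) auto
    also have "\<dots> = ?M $$ (i, j) - inverse x * ?M $$ (i, k)"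
      using kj by simp
    finally show ?thesis using i j k by simp
  qed
  have last: "N $$ (p, l) = x powi e l"
  proof -
    have "N $$ (p, l) = (\<Sum>m<?n. ?M $$ (p, m) * U $$ (m, l))"
      using p M U unfolding N_def by (simp add: scalar_prod_def lessThan_atLeast0)
    also have "\<dots> = (\<Sum>m<?n. if m = l then ?M $$ (p, m) else 0)"
    proof (intro sum.cong refl)
      fix m assume m: "m \<in> {..<?n}"
      then have "e m = e l \<longleftrightarrow> m = l" "e m \<noteq> e l + 1"
        using inj[of m l] bij_betw_apply[OF e m] el by auto
      then show "?M $$ (p, m) * U $$ (m, l) = (if m = l then ?M $$ (p, m) else 0)"
        using m by (simp add: U_def)
    qed
    also have "\<dots> = x powi e l" using p by simp
    finally show ?thesis .
  qed
  have zero: "N $$ (p, j) = 0" if "j < l" for j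
    using entry[of p j] that p x by (simp add: power_int_add)
  have "det ?M = det N"
    unfolding N_def det_mult[OF M U] using det_shift_matrix[OF e, of "inverse x"] by (simp add: U_def)
  also have "\<dots> = (\<Sum>j<?n. N $$ (p, j) * cofactor N p j)"
    by (rule laplace_expansion_row[OF N]) (use p in simp)
  also have "\<dots> = x powi e l * cofactor N p l"
    by (simp add: zero last)
  also have "mat_delete N p l = mat_delete ?R p l"
    unfolding mat_delete_def using N p by (intro eq_matI) (auto simp: entry)
  then have "cofactor N p l = (-1) ^ (p + l) * det (mat_delete ?R p l)"
    by (simp add: cofactor_def)
  finally show ?thesis .
qed

lemma bij_betw_uminus_interval:
  fixes e :: "nat \<Rightarrow> int"
  assumes "bij_betw e A {a..<b}"
  shows "bij_betw (\<lambda>i. - e i) A {1 - b..<1 - a}"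
proof -
  have "bij_betw uminus {a..<b} {1 - b..<1 - a}"
    by (rule bij_betwI[of _ _ _ uminus]) auto
  from bij_betw_trans[OF assms this] show ?thesis by (simp add: comp_def)
qed

text \<open>The mirror image of \<open>det_power_row_max\<close> under \<open>e \<mapsto> -e\<close> and \<open>x \<mapsto> x\<^sup>-\<^sup>1\<close>, which leave the powers
  \<open>x\<^sup>e\<^sup>(\<^sup>j\<^sup>)\<close> unchanged.\<close>

lemma det_power_row_min:
  fixes F :: "nat \<Rightarrow> int \<Rightarrow> 'a :: field" and e :: "nat \<Rightarrow> int"
  assumes e: "bij_betw e {..<Suc l} {a..<a + int (Suc l)}" and el: "e l = a"
    and x: "x \<noteq> 0" and p: "p \<le> l"
  shows "det (mat (Suc l) (Suc l) (\<lambda>(i, j). if i = p then x powi e j else F i (e j))) =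
    x powi e l * ((-1) ^ (p + l) *
      det (mat_delete (mat (Suc l) (Suc l) (\<lambda>(i, j). F i (e j) - x * F i (e j - 1))) p l))"
proof -
  have "bij_betw (\<lambda>i. - e i) {..<Suc l} {- a - int l..<- a - int l + int (Suc l)}"
    using bij_betw_uminus_interval[OF e] by (simp add: algebra_simps)
  moreover have "- e l = - a - int l + int l" by (simp add: el)
  ultimately show ?thesis
    using det_power_row_max[of "\<lambda>i. - e i" l "- a - int l" "inverse x" p "\<lambda>i k. F i (- k)"] x p
    by (simp add: power_int_minus power_int_inverse cong: if_cong)
qed

lemma mat_adjoint_index:
  "i < dim_col A \<Longrightarrow> j < dim_row A \<Longrightarrow> mat_adjoint A $$ (i, j) = conjugate (A $$ (j, i))"
  by (simp add: mat_adjoint_def mat_of_rows_index)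

lemma dim_mat_adjoint [simp]: "dim_row (mat_adjoint A) = dim_col A" "dim_col (mat_adjoint A) = dim_row A"
  by (simp_all add: mat_adjoint_def)

lemma mat_inverse_det:
  fixes A :: "'a :: field mat"
  assumes A: "A \<in> carrier_mat n n" and d: "det A \<noteq> 0"
  shows "the (mat_inverse A) \<in> carrier_mat n n" "A * the (mat_inverse A) = 1\<^sub>m n"
    "the (mat_inverse A) * A = 1\<^sub>m n"
    "j < n \<Longrightarrow> i < n \<Longrightarrow> the (mat_inverse A) $$ (i, j) = cofactor A j i / det A"
proof -
  have "mat_inverse A \<noteq> None"
    using mat_inverse(1)[OF A, where b = "()"] det_non_zero_imp_unit[OF A d, where b = "()"] by blast
  then obtain B where B: "mat_inverse A = Some B" by blast
  note i = mat_inverse(2)[OF A B]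
  have dims: "dim_row B = n" "dim_col B = n" using i by auto
  from i B show "the (mat_inverse A) \<in> carrier_mat n n" "A * the (mat_inverse A) = 1\<^sub>m n"
    "the (mat_inverse A) * A = 1\<^sub>m n" by auto
  have adj: "adj_mat A \<in> carrier_mat n n" "A * adj_mat A = det A \<cdot>\<^sub>m 1\<^sub>m n"
    using adj_mat[OF A] by auto
  have "adj_mat A = (B * A) * adj_mat A" using i adj by simp
  also have "\<dots> = B * (det A \<cdot>\<^sub>m 1\<^sub>m n)"
    using assoc_mult_mat[of B n n A n "adj_mat A" n] i adj A by metis
  also have "\<dots> = det A \<cdot>\<^sub>m B" 
    using mult_smult_distrib[of B n n "1\<^sub>m n" n "det A"] i by auto
  finally have "adj_mat A $$ (i, j) = det A * B $$ (i, j)" if "i < n" "j < n" for i j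
    using dims that by simp
  then show "j < n \<Longrightarrow> i < n \<Longrightarrow> the (mat_inverse A) $$ (i, j) = cofactor A j i / det A"
    using A d B by (simp add: adj_mat_def field_simps)
qed

text \<open>The entries of the inverse are cofactors divided by the determinant, and the cofactors along row
  \<open>p\<close> are insensitive to the entries of that row: the second identity is the expansion along row \<open>p\<close>.\<close>

lemma cnj_unit_vec_adjoint_inverse:
  fixes A :: "complex mat"
  assumes A: "A \<in> carrier_mat n n" and d: "det A \<noteq> 0" and p: "p < n"
    and v: "v \<in> carrier_vec n"
  shows "cnj (scalar_prod (unit_vec n p) (mat_adjoint (the (mat_inverse A)) *\<^sub>v v)) =
      (\<Sum>k<n. the (mat_inverse A) $$ (k, p) * cnj (v $ k))" (is ?sum)
    and "cnj (scalar_prod (unit_vec n p) (mat_adjoint (the (mat_inverse A)) *\<^sub>v v)) =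
      det (mat n n (\<lambda>(i, j). if i = p then cnj (v $ j) else A $$ (i, j))) / det A"
proof -
  let ?B = "the (mat_inverse A)"
  have B: "?B \<in> carrier_mat n n" by (rule mat_inverse_det[OF A d])
  have "scalar_prod (unit_vec n p) (mat_adjoint ?B *\<^sub>v v) = (mat_adjoint ?B *\<^sub>v v) $ p"
    using B p by (intro scalar_prod_left_unit) (auto intro!: carrier_vecI)
  also have "\<dots> = (\<Sum>k<n. cnj (?B $$ (k, p)) * v $ k)"
    using B p v by (simp add: scalar_prod_def mat_adjoint_index lessThan_atLeast0)
  finally show ?sum by simp
  let ?N = "mat n n (\<lambda>(i, j). if i = p then cnj (v $ j) else A $$ (i, j))"
  have "det ?N = (\<Sum>k<n. ?N $$ (p, k) * cofactor ?N p k)"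
    by (rule laplace_expansion_row) (use p in simp_all)
  also have "\<dots> = (\<Sum>k<n. cnj (v $ k) * cofactor A p k)"
  proof (intro sum.cong refl)
    fix k assume k: "k \<in> {..<n}"
    have "mat_delete ?N p k = mat_delete A p k"
      using A p k by (intro eq_matI) (auto simp: mat_delete_def)
    then show "?N $$ (p, k) * cofactor ?N p k = cnj (v $ k) * cofactor A p k"
      using p k by (simp add: cofactor_def)
  qed
  finally show "cnj (scalar_prod (unit_vec n p) (mat_adjoint ?B *\<^sub>v v)) = det ?N / det A"
    unfolding \<open>?sum\<close> using mat_inverse_det(4)[OF A d p]
    by (simp add: sum_divide_distrib mult.commute)
qed

text \<open>The left-hand side is the Schur complement of \<open>A\<close> in the bordered matrix.\<close>

lemma cnj_diff_adjoint_inverse: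
  fixes A :: "complex mat" and b :: "nat \<Rightarrow> complex"
  assumes A: "A \<in> carrier_mat n n" and d: "det A \<noteq> 0" and v: "v \<in> carrier_vec n"
  shows "cnj (s - scalar_prod (vec n (\<lambda>i. cnj (b i))) (mat_adjoint (the (mat_inverse A)) *\<^sub>v v)) =
      det (mat (Suc n) (Suc n) (\<lambda>(i, j). if i = n then (if j = n then cnj s else cnj (v $ j))
             else (if j = n then b i else A $$ (i, j)))) / det A"
proof -
  let ?B = "the (mat_inverse A)" and ?n = "Suc n"
  let ?M = "mat (Suc n) (Suc n) (\<lambda>(i, j). if i = n then (if j = n then cnj s else cnj (v $ j))
             else (if j = n then b i else A $$ (i, j)))"
  have B: "?B \<in> carrier_mat n n" and AB: "A * ?B = 1\<^sub>m n" by (rule mat_inverse_det[OF A d])+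
  \<comment> \<open>Subtracting the combination of the first columns with coefficients \<open>y = A\<^sup>-\<^sup>1 b\<close> clears the border
    column above its last entry.\<close>
  define y where "y k = (\<Sum>i<n. ?B $$ (k, i) * b i)" for k
  have "scalar_prod (vec n (\<lambda>i. cnj (b i))) (mat_adjoint ?B *\<^sub>v v) =
      (\<Sum>i<n. cnj (b i) * (\<Sum>k<n. cnj (?B $$ (k, i)) * v $ k))"
    using B v by (simp add: scalar_prod_def mat_adjoint_index lessThan_atLeast0)
  also have "cnj \<dots> = (\<Sum>i<n. \<Sum>k<n. b i * ?B $$ (k, i) * cnj (v $ k))"
    by (simp add: sum_distrib_left mult.assoc)
  also have "\<dots> = (\<Sum>k<n. \<Sum>i<n. b i * ?B $$ (k, i) * cnj (v $ k))"
    by (rule sum.swap)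
  also have "\<dots> = (\<Sum>k<n. cnj (v $ k) * y k)"
    by (simp add: y_def sum_distrib_left mult_ac)
  finally have lhs: "cnj (s - scalar_prod (vec n (\<lambda>i. cnj (b i))) (mat_adjoint ?B *\<^sub>v v)) =
      cnj s - (\<Sum>k<n. cnj (v $ k) * y k)" by simp
  have Ay: "(\<Sum>k<n. A $$ (i, k) * y k) = b i" if i: "i < n" for i
  proof -
    have "(\<Sum>k<n. A $$ (i, k) * y k) = (\<Sum>k<n. \<Sum>m<n. A $$ (i, k) * ?B $$ (k, m) * b m)"
      by (simp add: y_def sum_distrib_left mult.assoc)
    also have "\<dots> = (\<Sum>m<n. \<Sum>k<n. A $$ (i, k) * ?B $$ (k, m) * b m)"
      by (rule sum.swap)
    also have "\<dots> = (\<Sum>m<n. (A * ?B) $$ (i, m) * b m)"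
      using A B i by (simp add: scalar_prod_def lessThan_atLeast0 sum_distrib_right)
    also have "\<dots> = (\<Sum>m<n. if m = i then b m else 0)"
      unfolding AB using i by (intro sum.cong) auto
    also have "\<dots> = b i" using i by simp
    finally show ?thesis .
  qed
  define U where "U = mat ?n ?n (\<lambda>(i, j). if i = j then 1 else if j = n then - y i else 0)"
  define N where "N = ?M * U"
  have M: "?M \<in> carrier_mat ?n ?n" and U: "U \<in> carrier_mat ?n ?n" by (simp_all add: U_def)
  from mult_carrier_mat[OF this] have N: "N \<in> carrier_mat ?n ?n" by (simp only: N_def)
  have "det U = prod_list (diag_mat U)"
    by (rule det_upper_triangular[OF _ U]) (auto simp: U_def upper_triangular_def)
  also have "diag_mat U = replicate ?n 1"
    unfolding diag_mat_def U_def by (intro nth_equalityI) (auto simp del: replicate_Suc upt_Suc)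
  finally have dU: "det U = 1" by simp
  have col: "N $$ (i, n) = ?M $$ (i, n) - (\<Sum>k<n. ?M $$ (i, k) * y k)" if "i < ?n" for i
  proof -
    have "N $$ (i, n) = (\<Sum>k<?n. ?M $$ (i, k) * U $$ (k, n))"
      using that M U unfolding N_def by (simp add: scalar_prod_def lessThan_atLeast0)
    also have "\<dots> = ?M $$ (i, n) - (\<Sum>k<n. ?M $$ (i, k) * y k)"
      by (simp add: U_def sum_negf)
    finally show ?thesis .
  qed
  have col0: "N $$ (i, n) = 0" if "i < n" for i
    using col[of i] Ay[of i] that by simp
  have coln: "N $$ (n, n) = cnj s - (\<Sum>k<n. cnj (v $ k) * y k)"
    using col[of n] by simp
  have "N $$ (i, j) = A $$ (i, j)" if "i < n" "j < n" for i j
  proof -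
    have "N $$ (i, j) = (\<Sum>k<?n. ?M $$ (i, k) * U $$ (k, j))"
      using that M U unfolding N_def by (simp add: scalar_prod_def lessThan_atLeast0)
    also have "\<dots> = (\<Sum>k<?n. if k = j then A $$ (i, j) else 0)"
      using that by (intro sum.cong) (auto simp: U_def)
    also have "\<dots> = A $$ (i, j)" using that by simp
    finally show ?thesis .
  qed
  then have "mat_delete N n n = A"
    using A N by (intro eq_matI) (auto simp: mat_delete_def)
  then have cof: "cofactor N n n = det A"
    by (simp add: cofactor_def flip: mult_2)
  have "det ?M = det N"
    unfolding N_def det_mult[OF M U] dU by simp
  also have "\<dots> = (\<Sum>i<?n. N $$ (i, n) * cofactor N i n)"
    by (rule laplace_expansion_column[OF N]) simp
  also have "\<dots> = (cnj s - (\<Sum>k<n. cnj (v $ k) * y k)) * det A"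
    by (simp add: col0 coln cof)
  finally show ?thesis unfolding lhs using d by simp
qed


section \<open>Truncation of the Gauss--Borel factorization\<close>

lemma inf_mult_lower:
  assumes "lower_tri A"
  shows "inf_mult A B i j = (\<Sum>k\<le>i. A i k * B k j)"
  unfolding inf_mult_def
  by (rule suminf_finite) (use assms in \<open>auto simp: lower_tri_def\<close>)

lemma inf_mult_upper:
  assumes "upper_tri B"
  shows "inf_mult A B i j = (\<Sum>k\<le>j. A i k * B k j)"
  unfolding inf_mult_def
  by (rule suminf_finite) (use assms in \<open>auto simp: upper_tri_def\<close>)

lemma lead_carrier [simp]: "lead n A \<in> carrier_mat n n"
  and lead_dim [simp]: "dim_row (lead n A) = n" "dim_col (lead n A) = n"
  by (simp_all add: lead_def)

lemma lead_index [simp]: "i < n \<Longrightarrow> j < n \<Longrightarrow> lead n A $$ (i, j) = A i j"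
  by (simp add: lead_def)

lemma lead_inf_one: "lead n inf_one = 1\<^sub>m n"
  by (rule eq_matI) (auto simp: inf_one_def)

text \<open>The sum defining an entry of the product stops at its row index if the left factor is lower
  triangular, and at its column index if the right factor is upper triangular. This reduces the semi-infinite matrices below to finite
  ones.\<close>

lemma lead_inf_mult_lower:
  assumes A: "lower_tri A"
  shows "lead n (inf_mult A B) = lead n A * lead n B"
proof (rule eq_matI)
  fix i j assume "i < dim_row (lead n A * lead n B)" "j < dim_col (lead n A * lead n B)"
  then have ij: "i < n" "j < n" by simp_all
  have "(\<Sum>k\<le>i. A i k * B k j) = (\<Sum>k<n. A i k * B k j)"
    using ij A by (intro sum.mono_neutral_left) (auto simp: lower_tri_def)
  then show "lead n (inf_mult A B) $$ (i, j) = (lead n A * lead n B) $$ (i, j)"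
    using ij by (simp add: inf_mult_lower[OF A] scalar_prod_def lessThan_atLeast0)
qed simp_all

lemma lead_inf_mult_upper:
  assumes B: "upper_tri B"
  shows "lead n (inf_mult A B) = lead n A * lead n B"
proof (rule eq_matI)
  fix i j assume "i < dim_row (lead n A * lead n B)" "j < dim_col (lead n A * lead n B)"
  then have ij: "i < n" "j < n" by simp_all
  have "(\<Sum>k\<le>j. A i k * B k j) = (\<Sum>k<n. A i k * B k j)"
    using ij B by (intro sum.mono_neutral_left) (auto simp: upper_tri_def)
  then show "lead n (inf_mult A B) $$ (i, j) = (lead n A * lead n B) $$ (i, j)"
    using ij by (simp add: inf_mult_upper[OF B] scalar_prod_def lessThan_atLeast0)
qed simp_all

lemma inf_mat_eqI:
  assumes "\<And>n. lead n A = lead n B"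
  shows "A = B"
proof (intro ext)
  fix i j
  show "A i j = B i j"
    using arg_cong[OF assms, of "\<lambda>M. M $$ (i, j)" "Suc (max i j)"] by simp
qed

text \<open>Solving \<open>A B = 1\<close> row by row shows that the inverse within the lower triangular matrices
  exists.\<close>

fun forward_subst :: "inf_mat \<Rightarrow> inf_mat" where
  "forward_subst A i j = ((if i = j then 1 else 0) - (\<Sum>k<i. A i k * forward_subst A k j)) / A i i"

declare forward_subst.simps [simp del]

lemma forward_subst_lower_tri: "lower_tri (forward_subst A)"
proof -
  have "i < j \<Longrightarrow> forward_subst A i j = 0" for i j
    by (induction i rule: less_induct) (subst forward_subst.simps, simp)
  then show ?thesis by (simp add: lower_tri_def)
qed

lemma lower_inverse_unique:
  assumes A: "lower_tri A" and B: "lower_tri B"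
    and BA: "inf_mult B A = inf_one" and AC: "inf_mult A C = inf_one"
  shows "B = C"
proof (rule inf_mat_eqI)
  fix n
  have BA': "lead n B * lead n A = 1\<^sub>m n"
    using arg_cong[OF BA, of "lead n"] by (simp add: lead_inf_mult_lower[OF B] lead_inf_one)
  have AC': "lead n A * lead n C = 1\<^sub>m n"
    using arg_cong[OF AC, of "lead n"] by (simp add: lead_inf_mult_lower[OF A] lead_inf_one)
  have "lead n B = lead n B * (lead n A * lead n C)"
    unfolding AC' by (rule right_mult_one_mat[symmetric, OF lead_carrier])
  also have "\<dots> = lead n B * lead n A * lead n C"
    by (rule assoc_mult_mat[symmetric, OF lead_carrier lead_carrier lead_carrier])
  also have "\<dots> = lead n C"
    unfolding BA' by (rule left_mult_one_mat[OF lead_carrier])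
  finally show "lead n B = lead n C" .
qed

lemma lower_inv_props:
  assumes A: "lower_tri A" and d: "\<And>i. A i i \<noteq> 0"
  shows "lower_tri (lower_inv A)" "inf_mult A (lower_inv A) = inf_one" "inf_mult (lower_inv A) A = inf_one"
proof -
  let ?P = "\<lambda>B. lower_tri B \<and> inf_mult A B = inf_one \<and> inf_mult B A = inf_one"
  let ?F = "forward_subst A"
  note F = forward_subst_lower_tri[of A]
  have AF: "inf_mult A ?F = inf_one"
  proof (intro ext)
    fix i j
    have "inf_mult A ?F i j = (\<Sum>k<i. A i k * ?F k j) + A i i * ?F i j"
      by (simp add: inf_mult_lower[OF A] flip: lessThan_Suc_atMost)
    also have "A i i * ?F i j = (if i = j then 1 else 0) - (\<Sum>k<i. A i k * ?F k j)"
      by (subst forward_subst.simps) (simp add: d)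
    finally show "inf_mult A ?F i j = inf_one i j" by (simp add: inf_one_def)
  qed
  have "inf_mult ?F A = inf_one"
  proof (rule inf_mat_eqI)
    fix n
    have "lead n A * lead n ?F = 1\<^sub>m n"
      using arg_cong[OF AF, of "lead n"] by (simp add: lead_inf_mult_lower[OF A] lead_inf_one)
    then have "lead n ?F * lead n A = 1\<^sub>m n"
      by (rule mat_mult_left_right_inverse[OF lead_carrier lead_carrier])
    then show "lead n (inf_mult ?F A) = lead n inf_one"
      by (simp add: lead_inf_mult_lower[OF F] lead_inf_one)
  qed
  with F AF have P: "?P ?F" by simp
  have "B = ?F" if "?P B" for B
    using lower_inverse_unique[OF A] that AF by blast
  with P have "?P (lower_inv A)"
    unfolding lower_inv_def by (intro theI[of ?P])
  then show "lower_tri (lower_inv A)" "inf_mult A (lower_inv A) = inf_one" "inf_mult (lower_inv A) A = inf_one"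
    by blast+
qed

lemma lower_unitri_lower_inv:
  assumes A: "lower_unitri A"
  shows "lower_unitri (lower_inv A)"
proof -
  have t: "lower_tri A" and d: "\<And>i. A i i = 1" using A by (auto simp: lower_unitri_def)
  then have "\<And>i. A i i \<noteq> 0" by simp
  note i = lower_inv_props[OF t this]
  have "lower_inv A j j = 1" for j
  proof -
    have "1 = inf_mult A (lower_inv A) j j" by (simp add: i inf_one_def)
    also have "\<dots> = (\<Sum>k<j. A j k * lower_inv A k j) + A j j * lower_inv A j j"
      by (simp add: inf_mult_lower[OF t] flip: lessThan_Suc_atMost)
    also have "\<dots> = lower_inv A j j" using i(1) d by (simp add: lower_tri_def)
    finally show ?thesis by simp
  qed
  with i show ?thesis by (simp add: lower_unitri_def)
qed

text \<open>Transposition reverses products and exchanges the two triangular shapes.\<close>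

lemma upper_inv_props:
  assumes A: "upper_tri A" and d: "\<And>i. A i i \<noteq> 0"
  shows "upper_tri (upper_inv A)" "inf_mult A (upper_inv A) = inf_one" "inf_mult (upper_inv A) A = inf_one"
proof -
  let ?t = "\<lambda>A i j. A j i :: complex"
  let ?P = "\<lambda>B. upper_tri B \<and> inf_mult A B = inf_one \<and> inf_mult B A = inf_one"
  let ?Q = "\<lambda>B. lower_tri B \<and> inf_mult (?t A) B = inf_one \<and> inf_mult B (?t A) = inf_one"
  have t1: "inf_mult B C = inf_one \<longleftrightarrow> inf_mult (?t C) (?t B) = inf_one" for B C
    by (auto simp: inf_mult_def fun_eq_iff inf_one_def mult.commute)
  have PQ: "?P B \<longleftrightarrow> ?Q (?t B)" for B
    using t1[of A B] t1[of B A] by (auto simp: upper_tri_def lower_tri_def)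
  have low: "lower_tri (?t A)" using A by (simp add: upper_tri_def lower_tri_def)
  have ex1: "\<exists>!B. ?Q B"
  proof (rule ex1I)
    show "?Q (lower_inv (?t A))" using lower_inv_props[OF low] d by blast
    fix B assume "?Q B"
    then show "B = lower_inv (?t A)"
      using lower_inverse_unique[OF low] lower_inv_props(2)[OF low] d by blast
  qed
  then obtain B where B: "?Q B" "\<And>C. ?Q C \<Longrightarrow> C = B" by blast
  have "?P (upper_inv A)"
    unfolding upper_inv_def
  proof (rule theI[of ?P])
    show "?P (?t B)" unfolding PQ by (rule B(1))
    show "C = ?t B" if "?P C" for C
      using B(2)[of "?t C"] that unfolding PQ by (simp add: fun_eq_iff)
  qed
  then show "upper_tri (upper_inv A)" "inf_mult A (upper_inv A) = inf_one" "inf_mult (upper_inv A) A = inf_one"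
    by blast+
qed

lemma gauss_borel_lead:
  assumes "gauss_borel g S1 S2"
  shows "lead n g = lead n (lower_inv S1) * lead n S2"
  using assms lead_inf_mult_upper[of S2 n "lower_inv S1"] by (simp add: gauss_borel_def)

text \<open>The unitriangular factor does not change the leading minors, so that those of \<open>g\<close> are the partial
  products of the diagonal of \<open>S\<^sub>2\<close>.\<close>

lemma gauss_borel_det_Suc:
  assumes g: "gauss_borel g S1 S2"
  shows "det (lead (Suc n) g) = det (lead n g) * S2 n n"
proof -
  have L: "lower_unitri (lower_inv S1)" and S2: "upper_tri S2"
    using g lower_unitri_lower_inv by (auto simp: gauss_borel_def)
  have "det (lead n (lower_inv S1)) = prod_list (diag_mat (lead n (lower_inv S1)))" for n
    by (rule det_lower_triangular[of n]) (use L in \<open>auto simp: lower_unitri_def lower_tri_def\<close>)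
  moreover have "diag_mat (lead n (lower_inv S1)) = replicate n 1" for n
    unfolding diag_mat_def using L by (intro nth_equalityI) (auto simp: lower_unitri_def)
  ultimately have 1: "det (lead n (lower_inv S1)) = 1" for n by simp
  have 2: "det (lead n S2) = prod_list (diag_mat (lead n S2))" for n
    by (rule det_upper_triangular[of _ n]) (use S2 in \<open>auto simp: upper_tri_def upper_triangular_def\<close>)
  have 3: "diag_mat (lead n S2) = map (\<lambda>i. S2 i i) [0..<n]" for n
    by (simp add: diag_mat_def)
  have "det (lead n g) = det (lead n S2)" for n
    unfolding gauss_borel_lead[OF g] by (subst det_mult[of _ n]) (simp_all add: 1)
  then show ?thesis by (simp add: 2 3)
qed

text \<open>On leading blocks \<open>S\<^sub>2\<^sup>-\<^sup>1 = g\<^sup>-\<^sup>1 S\<^sub>1\<^sup>-\<^sup>1\<close>, and the last column of a lower unitriangular block is the last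
  unit vector.\<close>

lemma gauss_borel_upper_inv_column:
  assumes g: "gauss_borel g S1 S2" and d: "\<And>n. det (lead n g) \<noteq> 0" and k: "k \<le> l"
  shows "upper_inv S2 k l = the (mat_inverse (lead (Suc l) g)) $$ (k, l)"
proof -
  let ?n = "Suc l"
  let ?B = "the (mat_inverse (lead ?n g))" and ?L = "lead ?n (lower_inv S1)"
    and ?U = "lead ?n (upper_inv S2)"
  have L: "lower_unitri (lower_inv S1)" and S2: "upper_tri S2"
    using g lower_unitri_lower_inv by (auto simp: gauss_borel_def)
  have "S2 i i \<noteq> 0" for i
    using gauss_borel_det_Suc[OF g, of i] d[of "Suc i"] by auto
  note U = upper_inv_props[OF S2 this]
  note B = mat_inverse_det[OF lead_carrier d[of ?n]]
  have SU: "lead ?n S2 * ?U = 1\<^sub>m ?n"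
    using arg_cong[OF U(2), of "lead ?n"] by (simp add: lead_inf_mult_upper[OF U(1)] lead_inf_one)
  have "?B * ?L = ?B * (?L * (lead ?n S2 * ?U))"
    using B(1) by (simp add: SU)
  also have "\<dots> = ?B * (lead ?n g * ?U)"
    by (simp add: gauss_borel_lead[OF g] assoc_mult_mat[of _ ?n ?n _ ?n _ ?n])
  also have "\<dots> = ?B * lead ?n g * ?U"
    by (rule assoc_mult_mat[symmetric, OF B(1) lead_carrier lead_carrier])
  also have "\<dots> = ?U" by (simp add: B(3))
  finally have "?U $$ (k, l) = (?B * ?L) $$ (k, l)" by simp
  also have "\<dots> = (\<Sum>m<?n. ?B $$ (k, m) * lower_inv S1 m l)"
    using B(1) k by (simp add: scalar_prod_def lessThan_atLeast0)
  also have "\<dots> = ?B $$ (k, l)"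
    using L by (simp add: lower_unitri_def lower_tri_def)
  finally show ?thesis using k by simp
qed

lemma cnj_phi2_eq:
  assumes g: "gauss_borel g S1 S2" and d: "\<And>n. det (lead n g) \<noteq> 0"
  shows "cnj (phi2 np nm S2 l z) =
    (\<Sum>k<Suc l. the (mat_inverse (lead (Suc l) g)) $$ (k, l) * cnj (chi np nm k z))"
proof -
  have S2: "upper_tri S2" using g by (auto simp: gauss_borel_def)
  have "S2 i i \<noteq> 0" for i
    using gauss_borel_det_Suc[OF g, of i] d[of "Suc i"] by auto
  note U = upper_inv_props[OF S2 this]
  have "phi2 np nm S2 l z = (\<Sum>k<Suc l. inf_adjoint (upper_inv S2) l k * chi np nm k z)"
    unfolding phi2_def
    by (rule suminf_finite) (use U(1) in \<open>auto simp: upper_tri_def inf_adjoint_def\<close>)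
  also have "cnj \<dots> = (\<Sum>k<Suc l. upper_inv S2 k l * cnj (chi np nm k z))"
    by (simp add: inf_adjoint_def del: sum.lessThan_Suc)
  also have "\<dots> = (\<Sum>k<Suc l. the (mat_inverse (lead (Suc l) g)) $$ (k, l) * cnj (chi np nm k z))"
    by (intro sum.cong refl) (simp add: gauss_borel_upper_inv_column[OF g d])
  finally show ?thesis .
qed


section \<open>Dual and associated polynomials as determinants\<close>

text \<open>The leading block is the Toeplitz matrix of size \<open>n\<close> with rows and columns listed in the extended
  ordering.\<close>

lemma det_lead_moment_matrix_nonzero:
  assumes np: "np \<ge> 1" and q: "quasi_definite \<mu>"
  shows "det (lead n (moment_matrix np nm \<mu>)) \<noteq> 0"
proof (cases n)
  case 0
  then show ?thesis by (simp add: det_dim_zero)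
next
  case (Suc m)
  let ?a = "- int (count_kind np nm 2 n)"
  let ?T = "mat n n (\<lambda>(i, j). moment \<mu> (int i - int j))"
  have bij: "bij_betw (chi_exp np nm) {..<n} {?a..<?a + int n}"
  proof -
    note b = chi_exp_bij_betw_interval[OF np, of nm n]
    have "int n = int (count_kind np nm 1 n) - ?a"
      using bij_betw_same_card[OF b] by simp
    with b show ?thesis by simp
  qed
  have "lead n (moment_matrix np nm \<mu>) =
      mat n n (\<lambda>(i, j). moment \<mu> (chi_exp np nm i - chi_exp np nm j))"
    by (simp add: lead_def moment_matrix_eq_moment)
  then have "det (lead n (moment_matrix np nm \<mu>)) = det ?T"
    using det_reindex_interval[OF bij, of "\<lambda>x y. moment \<mu> (x - y)"] by simp
  moreover have "invertible_mat ?T"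
    using q Suc by (simp add: quasi_definite_def moment_def)
  then obtain B where B: "inverts_mat ?T B" "inverts_mat B ?T"
    by (auto simp: invertible_mat_def)
  have "det ?T \<noteq> 0"
  proof -
    have TB: "?T * B = 1\<^sub>m n" using B(1) by (simp add: inverts_mat_def)
    have "dim_col B = n" using arg_cong[OF TB, of dim_col] by simp
    moreover have "dim_row B = n"
      using arg_cong[OF B(2)[unfolded inverts_mat_def], of dim_col] by simp
    ultimately have "B \<in> carrier_mat n n" by auto
    then have "det ?T * det B = 1"
      using arg_cong[OF TB, of det] by (simp add: det_mult[of _ n])
    then show ?thesis by auto
  qed
  ultimately show ?thesis by simp
qed

lemma mat_delete_lead: "mat_delete (lead (Suc l) A) l l = lead l A"
  by (rule eq_matI) (auto simp: mat_delete_def)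

lemma tau2_minus_self: "kind np nm l = a \<Longrightarrow> tau2_minus np nm a \<rho> l = tau np nm \<rho> l"
  by (simp add: tau2_minus_def tau_def prev_index_self mat_delete_lead flip: mult_2)

context
  fixes np nm :: nat and \<nu> :: "complex set \<Rightarrow> complex" and g :: inf_mat and z :: complex
  assumes np: "np \<ge> 1" and nm: "nm \<ge> 1" and cm: "complex_measure \<nu>" and qd: "quasi_definite \<nu>"
    and z: "z \<noteq> 0"
  defines "g \<equiv> moment_matrix np nm \<nu>"
begin

lemma det_lead_nonzero: "det (lead n g) \<noteq> 0"
  unfolding g_def by (rule det_lead_moment_matrix_nonzero[OF np qd])

lemma cnj_chi: "cnj (chi np nm k z) = cnj z powi chi_exp np nm k"
  by (simp add: chi_def)

lemma cnj_phi2_minus_eq_det: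
  assumes p: "prev_index np nm a l = p" and "p \<le> l"
  shows "cnj (phi2_minus np nm g a l z) =
    det (mat (Suc l) (Suc l) (\<lambda>(i, j). if i = p then cnj z powi chi_exp np nm j
            else moment \<nu> (chi_exp np nm i - chi_exp np nm j))) / det (lead (Suc l) g)"
    (is "_ = det ?M / _")
    and "cnj (phi2_minus np nm g a l z) =
      (\<Sum>k<Suc l. the (mat_inverse (lead (Suc l) g)) $$ (k, p) * cnj (chi np nm k z))"
proof -
  have v: "lead_chi np nm (Suc l) z \<in> carrier_vec (Suc l)" and "p < Suc l"
    using assms by (simp_all add: lead_chi_def)
  note * = cnj_unit_vec_adjoint_inverse[OF lead_carrier det_lead_nonzero this(2,1)]
  have "mat (Suc l) (Suc l) (\<lambda>(i, j). if i = p then cnj (lead_chi np nm (Suc l) z $ j)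
      else lead (Suc l) g $$ (i, j)) = ?M"
    by (rule eq_matI) (auto simp: lead_chi_def cnj_chi g_def moment_matrix_eq_moment)
  then show "cnj (phi2_minus np nm g a l z) = det ?M / det (lead (Suc l) g)"
    using *(2) by (simp add: phi2_minus_def p)
  show "cnj (phi2_minus np nm g a l z) =
      (\<Sum>k<Suc l. the (mat_inverse (lead (Suc l) g)) $$ (k, p) * cnj (chi np nm k z))"
    using *(1) by (simp add: phi2_minus_def p lead_chi_def)
qed

lemma cnj_phi2_plus_eq_det:
  defines "m \<equiv> \<lambda>a l. next_index np nm a l"
  shows "cnj (phi2_plus np nm g a l z) =
    det (mat (Suc l) (Suc l) (\<lambda>(i, j).
        if i = l then cnj z powi ((chi_exp np nm)(l := chi_exp np nm (m a l))) j
        else moment \<nu> (chi_exp np nm i - ((chi_exp np nm)(l := chi_exp np nm (m a l))) j)))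
      / det (lead l g)"
    (is "_ = det ?M / _")
proof -
  have v: "lead_chi np nm l z \<in> carrier_vec l" by (simp add: lead_chi_def)
  have "mat (Suc l) (Suc l) (\<lambda>(i, j).
      if i = l then (if j = l then cnj (chi np nm (m a l) z) else cnj (lead_chi np nm l z $ j))
      else (if j = l then g i (m a l) else lead l g $$ (i, j))) = ?M"
    by (rule eq_matI) (auto simp: lead_chi_def cnj_chi g_def moment_matrix_eq_moment)
  then show ?thesis
    using cnj_diff_adjoint_inverse[OF lead_carrier det_lead_nonzero v,
        of "chi np nm (m a l) z" "\<lambda>i. g i (m a l)"]
    by (simp add: phi2_plus_def m_def)
qed

lemma moment_matrix_miwa:
  shows "moment_matrix np nm (miwa_minus_1 w \<nu>) i j =
      moment \<nu> (chi_exp np nm i - chi_exp np nm j) - w * moment \<nu> (chi_exp np nm i - (chi_exp np nm j - 1))"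
    and "moment_matrix np nm (miwa_plus_2 w \<nu>) i j =
      moment \<nu> (chi_exp np nm i - chi_exp np nm j) - w * moment \<nu> (chi_exp np nm i - (chi_exp np nm j + 1))"
  unfolding moment_matrix_eq_moment moment_miwa_minus_1[OF cm] moment_miwa_plus_2[OF cm]
  by (simp_all add: algebra_simps)

text \<open>The first \<open>l\<close> exponents together with one that prolongs their interval on either side. Besides the
  exponent at position \<open>l\<close> itself this covers the exponent at \<open>l\<^bsub>+a\<^esub>\<close>, which labels the border column of \<open>\<phi>\<^bsub>2,+a\<^esub>\<close>.\<close>

lemma bij_betw_extended:
  fixes e :: int
  assumes "e = int (count_kind np nm 1 l) \<or> e = - int (count_kind np nm 2 l) - 1"
  defines "a \<equiv> min e (- int (count_kind np nm 2 l))"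
  shows "bij_betw ((chi_exp np nm)(l := e)) {..<Suc l} {a..<a + int (Suc l)}"
    and "e = int (count_kind np nm 1 l) \<Longrightarrow> e = a + int l"
    and "e = - int (count_kind np nm 2 l) - 1 \<Longrightarrow> e = a"
proof -
  let ?a = "- int (count_kind np nm 2 l)" and ?b = "int (count_kind np nm 1 l)"
  note b = chi_exp_bij_betw_interval[OF np, of nm l]
  have l: "int l = ?b - ?a" using bij_betw_same_card[OF b] by simp
  have "bij_betw ((chi_exp np nm)(l := e)) {..<l} {?a..<?b}"
    using b by (subst bij_betw_cong[of _ _ "chi_exp np nm"]) auto
  then have "bij_betw ((chi_exp np nm)(l := e)) ({..<l} \<union> {l}) ({?a..<?b} \<union> {e})"
    using assms(1) by (intro bij_betw_combine) auto
  moreover have "{?a..<?b} \<union> {e} = {a..<a + int (Suc l)}"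
    using assms(1) l by (auto simp: a_def)
  ultimately show "bij_betw ((chi_exp np nm)(l := e)) {..<Suc l} {a..<a + int (Suc l)}"
    by (simp add: lessThan_Suc)
  show "e = ?b \<Longrightarrow> e = a + int l" "e = ?a - 1 \<Longrightarrow> e = a"
    using l by (auto simp: a_def)
qed

text \<open>The minor that remains after the column operations avoids column \<open>l\<close>; so it is the same whichever
  exponent labels that column, and it is a minor of the moment matrix of the Miwa shift.\<close>

lemma det_power_row_moment:
  fixes e :: int
  assumes p: "p \<le> l"
  defines "E \<equiv> (chi_exp np nm)(l := e)"
  shows "e = int (count_kind np nm 1 l) \<Longrightarrow>
      det (mat (Suc l) (Suc l) (\<lambda>(i, j). if i = p then cnj z powi E j
             else moment \<nu> (chi_exp np nm i - E j))) =
      cnj z powi e * ((-1) ^ (p + l) *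
        det (mat_delete (lead (Suc l) (moment_matrix np nm (miwa_plus_2 (inverse (cnj z)) \<nu>))) p l))"
    and "e = - int (count_kind np nm 2 l) - 1 \<Longrightarrow>
      det (mat (Suc l) (Suc l) (\<lambda>(i, j). if i = p then cnj z powi E j
             else moment \<nu> (chi_exp np nm i - E j))) =
      cnj z powi e * ((-1) ^ (p + l) *
        det (mat_delete (lead (Suc l) (moment_matrix np nm (miwa_minus_1 (cnj z) \<nu>))) p l))"
proof -
  have x: "cnj z \<noteq> 0" using z by simp
  have del: "mat_delete (mat (Suc l) (Suc l) (\<lambda>(i, j). G i (E j))) p l =
      mat_delete (mat (Suc l) (Suc l) (\<lambda>(i, j). G i (chi_exp np nm j))) p l" for G :: "nat \<Rightarrow> int \<Rightarrow> complex"
    using p by (intro eq_matI) (auto simp: mat_delete_def E_def)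
  {
    assume e: "e = int (count_kind np nm 1 l)"
    show "det (mat (Suc l) (Suc l) (\<lambda>(i, j). if i = p then cnj z powi E j
             else moment \<nu> (chi_exp np nm i - E j))) =
      cnj z powi e * ((-1) ^ (p + l) *
        det (mat_delete (lead (Suc l) (moment_matrix np nm (miwa_plus_2 (inverse (cnj z)) \<nu>))) p l))"
      using det_power_row_max[OF bij_betw_extended(1)[OF disjI1[OF e]] _ x p,
          of "\<lambda>i k. moment \<nu> (chi_exp np nm i - k)"] bij_betw_extended(2)[OF disjI1[OF e] e]
        del[of "\<lambda>i k. moment \<nu> (chi_exp np nm i - k) - inverse (cnj z) * moment \<nu> (chi_exp np nm i - (k + 1))"]
      unfolding E_def by (simp add: lead_def moment_matrix_miwa fun_upd_same del: fun_upd_apply)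
  next
    assume e: "e = - int (count_kind np nm 2 l) - 1"
    show "det (mat (Suc l) (Suc l) (\<lambda>(i, j). if i = p then cnj z powi E j
             else moment \<nu> (chi_exp np nm i - E j))) =
      cnj z powi e * ((-1) ^ (p + l) *
        det (mat_delete (lead (Suc l) (moment_matrix np nm (miwa_minus_1 (cnj z) \<nu>))) p l))"
      using det_power_row_min[OF bij_betw_extended(1)[OF disjI2[OF e]] _ x p,
          of "\<lambda>i k. moment \<nu> (chi_exp np nm i - k)"] bij_betw_extended(3)[OF disjI2[OF e] e]
        del[of "\<lambda>i k. moment \<nu> (chi_exp np nm i - k) - cnj z * moment \<nu> (chi_exp np nm i - (k - 1))"]
      unfolding E_def by (simp add: lead_def moment_matrix_miwa fun_upd_same del: fun_upd_apply)
  }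
qed

lemma cnj_phi2_plus_1:
  "cnj (phi2_plus np nm g 1 l z) = cnj z powi (int (nu_plus np nm (next_index np nm 1 l)) - 1)
     * (tau np nm (miwa_plus_2 (inverse (cnj z)) \<nu>) l / tau np nm \<nu> l)"
  unfolding cnj_phi2_plus_eq_det
    det_power_row_moment(1)[OF order_refl chi_exp_next_index(1)[OF np nm]]
  using chi_exp_nu(1)[OF np next_index_props(2)[OF np nm, of 1 l]]
  by (simp add: mat_delete_lead tau_def g_def flip: mult_2)

lemma cnj_phi2_plus_2:
  "cnj (phi2_plus np nm g 2 l z) = cnj z powi (- int (nu_minus np nm (next_index np nm 2 l)))
     * (tau np nm (miwa_minus_1 (cnj z) \<nu>) l / tau np nm \<nu> l)"
  unfolding cnj_phi2_plus_eq_det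
    det_power_row_moment(2)[OF order_refl chi_exp_next_index(2)[OF np nm]]
  using chi_exp_nu(2)[OF np next_index_props(2)[OF np nm, of 2 l]]
  by (simp add: mat_delete_lead tau_def g_def flip: mult_2)

lemma cnj_phi2_minus:
  assumes a: "a = 1 \<or> a = 2" and l: "l \<ge> np + nm"
  shows "kind np nm l = 1 \<Longrightarrow> cnj (phi2_minus np nm g a l z) =
      cnj z powi (int (nu_plus np nm l) - 1)
       * (tau2_minus np nm a (miwa_plus_2 (inverse (cnj z)) \<nu>) l / tau np nm \<nu> (l + 1))"
    and "kind np nm l = 2 \<Longrightarrow> cnj (phi2_minus np nm g a l z) =
      cnj z powi (- int (nu_minus np nm l))
       * (tau2_minus np nm a (miwa_minus_1 (cnj z) \<nu>) l / tau np nm \<nu> (l + 1))"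
proof -
  note p = prev_index_le[OF np nm a l]
  show "cnj (phi2_minus np nm g a l z) =
      cnj z powi (int (nu_plus np nm l) - 1)
       * (tau2_minus np nm a (miwa_plus_2 (inverse (cnj z)) \<nu>) l / tau np nm \<nu> (l + 1))"
    if k: "kind np nm l = 1"
    using det_power_row_moment(1)[OF p chi_exp_eq_count(1)[OF np k]] chi_exp_nu(1)[OF np k]
    unfolding cnj_phi2_minus_eq_det(1)[OF refl p] fun_upd_triv
    by (simp add: tau_def tau2_minus_def g_def add.commute)
  show "cnj (phi2_minus np nm g a l z) =
      cnj z powi (- int (nu_minus np nm l))
       * (tau2_minus np nm a (miwa_minus_1 (cnj z) \<nu>) l / tau np nm \<nu> (l + 1))"
    if k: "kind np nm l = 2"
    using det_power_row_moment(2)[OF p chi_exp_eq_count(2)[OF np k]] chi_exp_nu(2)[OF np k]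
    unfolding cnj_phi2_minus_eq_det(1)[OF refl p] fun_upd_triv
    by (simp add: tau_def tau2_minus_def g_def add.commute)
qed

text \<open>If \<open>a\<close> is the kind of \<open>l\<close>, then \<open>l\<^bsub>+a\<^esub> = l\<^bsub>-a\<^esub> = l\<close>: the bordered block and the block with
  replaced row are the same matrix, and the two polynomials differ only by the normalization
  \<open>\<tau>\<^bsup>(l+1)\<^esup> / \<tau>\<^bsup>(l)\<^esup> = (S\<^sub>2)\<^sub>l\<^sub>l\<close>.\<close>

lemma cnj_phi2_eq_plus_minus:
  assumes gb: "gauss_borel g S1 S2" and k: "kind np nm l = a"
  shows "cnj (phi2 np nm S2 l z) = cnj (phi2_minus np nm g a l z)"
    and "inverse (S2 l l) * cnj (phi2_plus np nm g a l z) = cnj (phi2_minus np nm g a l z)"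
proof -
  note m = cnj_phi2_minus_eq_det[OF prev_index_self[OF k] order_refl]
  show "cnj (phi2 np nm S2 l z) = cnj (phi2_minus np nm g a l z)"
    unfolding m(2) by (rule cnj_phi2_eq[OF gb det_lead_nonzero])
  have "S2 l l \<noteq> 0"
    using gauss_borel_det_Suc[OF gb, of l] det_lead_nonzero[of "Suc l"] by auto
  then show "inverse (S2 l l) * cnj (phi2_plus np nm g a l z) = cnj (phi2_minus np nm g a l z)"
    unfolding m(1) cnj_phi2_plus_eq_det gauss_borel_det_Suc[OF gb] next_index_self[OF k] fun_upd_triv
    by (simp add: divide_inverse)
qed

end

theorem theorem10:
  fixes \<mu> \<nu> :: "complex set \<Rightarrow> complex" and t :: "nat \<Rightarrow> nat \<Rightarrow> complex"
    and np nm l :: nat and g S1 S2 :: inf_mat and z :: complex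
  assumes "complex_measure \<mu>"
    and "convergent_times t" and "cm_integrable \<mu> (time_factor t)"
    and "\<nu> = deformed t \<mu>" and "quasi_definite \<nu>"
    and "np \<ge> 1" and "nm \<ge> 1" and "l \<ge> np + nm"
    and "g = moment_matrix np nm \<nu>" and "gauss_borel g S1 S2"
    and "z \<noteq> 0"
  shows "
     (kind np nm l = 1 \<longrightarrow>
       cnj (phi2 np nm S2 l z) = inverse (S2 l l) * cnj (phi2_plus np nm g 1 l z) \<and>
       inverse (S2 l l) * cnj (phi2_plus np nm g 1 l z) = cnj (phi2_minus np nm g 1 l z) \<and>
       cnj (phi2_minus np nm g 1 l z) =
         cnj z powi (int (nu_plus np nm l) - 1)
         * (tau np nm (miwa_plus_2 (inverse (cnj z)) \<nu>) l / tau np nm \<nu> (l + 1))) \<and>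
     (kind np nm l = 2 \<longrightarrow>
       cnj (phi2 np nm S2 l z) = inverse (S2 l l) * cnj (phi2_plus np nm g 2 l z) \<and>
       inverse (S2 l l) * cnj (phi2_plus np nm g 2 l z) = cnj (phi2_minus np nm g 2 l z) \<and>
       cnj (phi2_minus np nm g 2 l z) =
         cnj z powi (- int (nu_minus np nm l))
         * (tau np nm (miwa_minus_1 (cnj z) \<nu>) l / tau np nm \<nu> (l + 1))) \<and>
     (kind np nm l = 1 \<longrightarrow>
       cnj (phi2_plus np nm g 2 l z) =
         cnj z powi (- int (nu_minus np nm (next_index np nm 2 l)))
         * (tau np nm (miwa_minus_1 (cnj z) \<nu>) l / tau np nm \<nu> l)) \<and>
     (kind np nm l = 2 \<longrightarrow>
       cnj (phi2_plus np nm g 1 l z) =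
         cnj z powi (int (nu_plus np nm (next_index np nm 1 l)) - 1)
         * (tau np nm (miwa_plus_2 (inverse (cnj z)) \<nu>) l / tau np nm \<nu> l)) \<and>
     (kind np nm l = 1 \<longrightarrow>
       cnj (phi2_minus np nm g 2 l z) =
         cnj z powi (int (nu_plus np nm l) - 1)
         * (tau2_minus np nm 2 (miwa_plus_2 (inverse (cnj z)) \<nu>) l / tau np nm \<nu> (l + 1))) \<and>
     (kind np nm l = 2 \<longrightarrow>
       cnj (phi2_minus np nm g 1 l z) =
         cnj z powi (- int (nu_minus np nm l))
         * (tau2_minus np nm 1 (miwa_minus_1 (cnj z) \<nu>) l / tau np nm \<nu> (l + 1)))"
proof -
  have cm: "complex_measure \<nu>"
    unfolding assms(4) deformed_def by (rule complex_measure_density[OF assms(3)])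
  note ctx = assms(6,7) cm assms(5,11)
  have gb: "gauss_borel (moment_matrix np nm \<nu>) S1 S2" using assms(9,10) by simp
  have a: "(1::nat) = 1 \<or> (1::nat) = 2" "(2::nat) = 1 \<or> (2::nat) = 2" by simp_all
  note minus1 = cnj_phi2_minus[OF ctx a(1) assms(8)] and minus2 = cnj_phi2_minus[OF ctx a(2) assms(8)]
  note eq = cnj_phi2_eq_plus_minus[OF ctx gb]
  note plus = cnj_phi2_plus_1[OF ctx] cnj_phi2_plus_2[OF ctx]
  have plus_first: "cnj (phi2 np nm S2 l z) =
      inverse (S2 l l) * cnj (phi2_plus np nm (moment_matrix np nm \<nu>) a l z)"
    if "kind np nm l = a" for a
    using eq[OF that] by simp
  have self: "cnj (phi2_minus np nm (moment_matrix np nm \<nu>) 1 l z) =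
         cnj z powi (int (nu_plus np nm l) - 1)
         * (tau np nm (miwa_plus_2 (inverse (cnj z)) \<nu>) l / tau np nm \<nu> (l + 1))"
    if k: "kind np nm l = 1"
    using minus1(1)[OF k] unfolding tau2_minus_self[OF k] .
  have self': "cnj (phi2_minus np nm (moment_matrix np nm \<nu>) 2 l z) =
         cnj z powi (- int (nu_minus np nm l))
         * (tau np nm (miwa_minus_1 (cnj z) \<nu>) l / tau np nm \<nu> (l + 1))"
    if k: "kind np nm l = 2"
    using minus2(2)[OF k] unfolding tau2_minus_self[OF k] .
  show ?thesis
    unfolding assms(9)
    by (intro conjI impI plus_first eq(2) self self' plus minus1(2) minus2(1))
qed

end
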